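(* Let $(X,d,A)$ be a metric pair with $A\neq\emptyset$ and assume that $X$ is locally compact. For $f\in\mathrm{Lip}_c(X,A)$ let $\hat f:\hat{\mathcal{M}}_1(X,A)\to\mathbb{R}$ be given by $\hat f(\mu)=\mu(f)$. Then $f\mapsto\hat f$ embeds $\mathrm{Lip}_c(X,A)$ as a Riesz subspace of the order continuous dual of $\hat{\mathcal{M}}_1(X,A)$, i.e. it is an injective linear map into the order continuous dual that preserves the lattice operations.
   Context: A metric pair $(X,d,A)$ is a metric space $(X,d)$ with a closed subset $A\subset X$; $d_A(x)=\inf_{a\in A}d(x,a)$. Measures take values in $[0,\infty]$. Let $\mathcal{B}^+(X)$ be the commutative monoid of Borel measures on $X$ and $\mathcal{B}^+(X,A)=\mathcal{B}^+(X)/\mathcal{B}^+(A)$ the quotient monoid: $\mu\sim\nu$ iff $\mu+\sigma=\nu+\tau$ for some Borel measures $\sigma,\tau$ concentrated on $A$; equivalently $\mu,\nu$ agree on Borel subsets of $X\setminus A$, so relative Borel measures correspond bijectively to Borel measures on $X\setminus A$. For $f$ vanishing on $A$, $\mu(f)=\int_X f\,d\mu=\int_{X\setminus A}f\,d\mu$ is well defined. $\mu\in\mathcal{B}^+(X,A)$ is tight if $\mu(E)=\sup\{\mu(K): K\subset E \text{ compact}\}$ for every Borel $E\subset X\setminus A$, and locally $1$-finite if each $x\in X$ (including $x\in A$) has a neighborhood $U$ with $\int_{U\setminus A}d_A\,d\mu<\infty$. $\hat{\mathcal{M}}_1^+(X,A)$ is the set of tight, locally $1$-finite $\mu\in\mathcal{B}^+(X,A)$.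 It is a cancellative commutative monoid with an $\mathbb{R}^+$-action, and $\hat{\mathcal{M}}_1(X,A)$ is its Grothendieck group (formal differences $\mu-\nu$), a Riesz space (vector lattice) with positive cone $\hat{\mathcal{M}}_1^+(X,A)$; put $(\mu-\nu)(f)=\mu(f)-\nu(f)$. $\mathrm{Lip}_c(X,A)$ is the Riesz space of Lipschitz functions $f:X\to\mathbb{R}$ with $f|_A=0$ and compact support in $X$, ordered pointwise. For a Riesz space $E$, a net $x_\alpha\xrightarrow{o}0$ if there is a decreasing net $(y_\alpha)$ with the same index set with infimum $0$ in $E$ and $|x_\alpha|\le y_\alpha$. The order continuous dual of $E$ is the Riesz space of order bounded linear functionals $T:E\to\mathbb{R}$ (those mapping order intervals to bounded sets) such that $x_\alpha\xrightarrow{o}0$ implies $T(x_\alpha)\xrightarrow{o}0$ in $\mathbb{R}$, ordered by the cone of positive functionals. *)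

theory Defs
  imports "HOL-Analysis.Analysis" "HOL-Algebra.Group"
begin

section \<open>Ordered vector spaces on a carrier\<close>

text \<open>
  The spaces below depend on the closed set \<open>A\<close>, so they are carriers with operations rather than
  types. Order notions (\<^const>\<open>is_lub\<close>, \<^const>\<open>is_glb\<close>, joins, meets, intervals) are those of
  HOL-Algebra for the underlying \<open>gorder\<close>, in which \<^const>\<open>eq\<close> is always equality.
\<close>

record 'e ordered_vs = "'e gorder" +
  vadd :: "'e \<Rightarrow> 'e \<Rightarrow> 'e"
  vzero :: 'e
  vscale :: "real \<Rightarrow> 'e \<Rightarrow> 'e"

definition real_vs :: "real ordered_vs" where
  "real_vs = \<lparr>carrier = UNIV, eq = (=), le = (\<le>), vadd = (+), vzero = 0, vscale = (*)\<rparr>"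

definition vabs :: "'e ordered_vs \<Rightarrow> 'e \<Rightarrow> 'e" where
  "vabs E x = x \<squnion>\<^bsub>E\<^esub> vscale E (-1) x"


section \<open>Order convergence and the order continuous dual\<close>

definition directed_index :: "'i set \<Rightarrow> ('i \<Rightarrow> 'i \<Rightarrow> bool) \<Rightarrow> bool" where
  "directed_index I r \<longleftrightarrow>
     I \<noteq> {} \<and> reflp_on I r \<and> transp_on I r \<and> (\<forall>i\<in>I. \<forall>j\<in>I. \<exists>k\<in>I. r i k \<and> r j k)"

definition order_null :: "'e ordered_vs \<Rightarrow> 'i set \<Rightarrow> ('i \<Rightarrow> 'i \<Rightarrow> bool) \<Rightarrow> ('i \<Rightarrow> 'e) \<Rightarrow> bool" where
  "order_null E I r x \<longleftrightarrow>
     (\<exists>y. (\<forall>i\<in>I. y i \<in> carrier E) \<and>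
          (\<forall>i\<in>I. \<forall>j\<in>I. r i j \<longrightarrow> y j \<sqsubseteq>\<^bsub>E\<^esub> y i) \<and>
          is_glb E (vzero E) (y ` I) \<and>
          (\<forall>i\<in>I. vabs E (x i) \<sqsubseteq>\<^bsub>E\<^esub> y i))"

definition linear_functional :: "'e ordered_vs \<Rightarrow> ('e \<Rightarrow> real) \<Rightarrow> bool" where
  "linear_functional E T \<longleftrightarrow>
     (\<forall>x\<in>carrier E. \<forall>y\<in>carrier E. T (vadd E x y) = T x + T y) \<and>
     (\<forall>c. \<forall>x\<in>carrier E. T (vscale E c x) = c * T x)"

definition order_bounded :: "'e ordered_vs \<Rightarrow> ('e \<Rightarrow> real) \<Rightarrow> bool" where
  "order_bounded E T \<longleftrightarrow> (\<forall>a\<in>carrier E. \<forall>b\<in>carrier E. bounded (T ` \<lbrace>a..b\<rbrace>\<^bsub>E\<^esub>))"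

text \<open>
  A HOL formula cannot quantify over all types of indices, so the index type of the nets is a
  parameter; index sets are arbitrary directed subsets of that type. Statements are meant to be read as
  holding for every \<open>'i\<close>.
\<close>

definition order_continuous :: "'i itself \<Rightarrow> 'e ordered_vs \<Rightarrow> ('e \<Rightarrow> real) \<Rightarrow> bool" where
  "order_continuous _ E T \<longleftrightarrow>
     (\<forall>(I :: 'i set) r x. directed_index I r \<longrightarrow> (\<forall>i\<in>I. x i \<in> carrier E) \<longrightarrow>
        order_null E I r x \<longrightarrow> order_null real_vs I r (\<lambda>i. T (x i)))"

text \<open>Functionals are extensional, so that they are determined by their values on the carrier.\<close>

definition order_continuous_dual :: "'i itself \<Rightarrow> 'e ordered_vs \<Rightarrow> ('e \<Rightarrow> real) ordered_vs" where
  "order_continuous_dual ity E =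
     \<lparr>carrier = {T \<in> extensional (carrier E).
                   linear_functional E T \<and> order_bounded E T \<and> order_continuous ity E T},
      eq = (=),
      le = (\<lambda>S T. \<forall>x\<in>carrier E. vzero E \<sqsubseteq>\<^bsub>E\<^esub> x \<longrightarrow> 0 \<le> T x - S x),
      vadd = (\<lambda>S T. \<lambda>x\<in>carrier E. S x + T x),
      vzero = (\<lambda>x\<in>carrier E. 0),
      vscale = (\<lambda>c T. \<lambda>x\<in>carrier E. c * T x)\<rparr>"

text \<open>
  Preservation of the lattice operations is phrased with \<^const>\<open>is_lub\<close> and \<^const>\<open>is_glb\<close> in the
  target, so that it includes the existence of these bounds there: \<open>join\<close> and \<open>meet\<close> are choice
  terms and would be arbitrary if the bounds did not exist.
\<close>

definition riesz_embedding :: "'e ordered_vs \<Rightarrow> 'f ordered_vs \<Rightarrow> ('e \<Rightarrow> 'f) \<Rightarrow> bool" where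
  "riesz_embedding E F h \<longleftrightarrow>
     h \<in> carrier E \<rightarrow> carrier F \<and> inj_on h (carrier E) \<and>
     (\<forall>x\<in>carrier E. \<forall>y\<in>carrier E. h (vadd E x y) = vadd F (h x) (h y)) \<and>
     (\<forall>c. \<forall>x\<in>carrier E. h (vscale E c x) = vscale F c (h x)) \<and>
     (\<forall>x\<in>carrier E. \<forall>y\<in>carrier E.
        is_lub F (h (x \<squnion>\<^bsub>E\<^esub> y)) {h x, h y} \<and> is_glb F (h (x \<sqinter>\<^bsub>E\<^esub> y)) {h x, h y})"


section \<open>Quotient monoids and the Grothendieck group\<close>

definition monoid_quot_rel :: "'m monoid \<Rightarrow> 'm set \<Rightarrow> ('m \<times> 'm) set" where
  "monoid_quot_rel G H =
     {(x, y) \<in> carrier G \<times> carrier G. \<exists>s\<in>H. \<exists>t\<in>H. x \<otimes>\<^bsub>G\<^esub> s = y \<otimes>\<^bsub>G\<^esub> t}"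

definition monoid_quot :: "'m monoid \<Rightarrow> 'm set \<Rightarrow> 'm set monoid" where
  "monoid_quot G H =
     \<lparr>carrier = carrier G // monoid_quot_rel G H,
      mult = (\<lambda>X Y. \<Union>x\<in>X. \<Union>y\<in>Y. monoid_quot_rel G H `` {x \<otimes>\<^bsub>G\<^esub> y}),
      one = monoid_quot_rel G H `` {\<one>\<^bsub>G\<^esub>}\<rparr>"

text \<open>A monoid (written multiplicatively, as in HOL-Algebra) with an action of the reals \<open>\<ge> 0\<close>.\<close>

record 'm cone = "'m monoid" +
  cscale :: "real \<Rightarrow> 'm \<Rightarrow> 'm"

text \<open>A pair \<open>(a, b)\<close> represents the formal difference \<open>a - b\<close>.\<close>

definition groth_rel :: "'m cone \<Rightarrow> (('m \<times> 'm) \<times> ('m \<times> 'm)) set" where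
  "groth_rel C =
     {((a, b), (c, d)). a \<in> carrier C \<and> b \<in> carrier C \<and> c \<in> carrier C \<and> d \<in> carrier C \<and>
        (\<exists>k\<in>carrier C. (a \<otimes>\<^bsub>C\<^esub> d) \<otimes>\<^bsub>C\<^esub> k = (c \<otimes>\<^bsub>C\<^esub> b) \<otimes>\<^bsub>C\<^esub> k)}"

definition groth_add :: "'m cone \<Rightarrow> ('m \<times> 'm) set \<Rightarrow> ('m \<times> 'm) set \<Rightarrow> ('m \<times> 'm) set" where
  "groth_add C X Y =
     (\<Union>(a, b)\<in>X. \<Union>(c, d)\<in>Y. groth_rel C `` {(a \<otimes>\<^bsub>C\<^esub> c, b \<otimes>\<^bsub>C\<^esub> d)})"

definition groth_scale :: "'m cone \<Rightarrow> real \<Rightarrow> ('m \<times> 'm) set \<Rightarrow> ('m \<times> 'm) set" where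
  "groth_scale C r X =
     (\<Union>(a, b)\<in>X. groth_rel C ``
        {if 0 \<le> r then (cscale C r a, cscale C r b) else (cscale C (-r) b, cscale C (-r) a)})"

text \<open>\<open>X \<le> Y\<close> iff \<open>Y = X + p\<close> for some \<open>p\<close> in the cone, i.e. \<open>Y - X\<close> lies in the positive cone.\<close>

definition grothendieck :: "'m cone \<Rightarrow> ('m \<times> 'm) set ordered_vs" where
  "grothendieck C =
     \<lparr>carrier = (carrier C \<times> carrier C) // groth_rel C,
      eq = (=),
      le = (\<lambda>X Y. \<exists>p\<in>carrier C. Y = groth_add C X (groth_rel C `` {(p, \<one>\<^bsub>C\<^esub>)})),
      vadd = groth_add C,
      vzero = groth_rel C `` {(\<one>\<^bsub>C\<^esub>, \<one>\<^bsub>C\<^esub>)},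
      vscale = groth_scale C\<rparr>"


section \<open>Relative Borel measures\<close>

definition measure_add :: "'a measure \<Rightarrow> 'a measure \<Rightarrow> 'a measure" where
  "measure_add M N = measure_of (space M) (sets M) (\<lambda>E. emeasure M E + emeasure N E)"

definition borel_measures :: "'a::topological_space measure monoid" where
  "borel_measures =
     \<lparr>carrier = {M. sets M = sets borel}, mult = measure_add, one = null_measure borel\<rparr>"

definition borel_measures_on :: "'a::topological_space set \<Rightarrow> 'a measure set" where
  "borel_measures_on A = {M \<in> carrier borel_measures. emeasure M (- A) = 0}"

definition rel_borel_measures :: "'a::topological_space set \<Rightarrow> 'a measure set monoid" where
  "rel_borel_measures A = monoid_quot borel_measures (borel_measures_on A)"

text \<open>
  The next two properties only involve the restriction of \<open>M\<close> to the complement of \<open>A\<close>, hence do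
  not depend on the representative of a relative measure. For \<open>A \<noteq> {}\<close>, \<^term>\<open>infdist x A\<close> is the
  distance function \<open>d\<^sub>A(x)\<close>.
\<close>

definition rel_tight :: "'a::topological_space set \<Rightarrow> 'a measure \<Rightarrow> bool" where
  "rel_tight A M \<longleftrightarrow>
     (\<forall>E\<in>sets borel. E \<subseteq> - A \<longrightarrow> emeasure M E = (SUP K\<in>{K. compact K \<and> K \<subseteq> E}. emeasure M K))"

definition locally_1_finite :: "'a::metric_space set \<Rightarrow> 'a measure \<Rightarrow> bool" where
  "locally_1_finite A M \<longleftrightarrow>
     (\<forall>x. \<exists>U. open U \<and> x \<in> U \<and> (\<integral>\<^sup>+y\<in>U - A. ennreal (infdist y A) \<partial>M) < \<infinity>)"

definition M1_cone :: "'a::metric_space set \<Rightarrow> 'a measure set cone" where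
  "M1_cone A =
     \<lparr>carrier = {m \<in> carrier (rel_borel_measures A). \<exists>M\<in>m. rel_tight A M \<and> locally_1_finite A M},
      mult = mult (rel_borel_measures A),
      one = one (rel_borel_measures A),
      cscale = (\<lambda>c m. \<Union>M\<in>m.
        monoid_quot_rel borel_measures (borel_measures_on A) `` {scale_measure (ennreal c) M})\<rparr>"

definition M1_space :: "'a::metric_space set \<Rightarrow> ('a measure set \<times> 'a measure set) set ordered_vs" where
  "M1_space A = grothendieck (M1_cone A)"


section \<open>Lipschitz functions and the pairing\<close>

definition Lip_c :: "'a::metric_space set \<Rightarrow> ('a \<Rightarrow> real) ordered_vs" where
  "Lip_c A =
     \<lparr>carrier = {f. (\<exists>L. L-lipschitz_on UNIV f) \<and> (\<forall>x\<in>A. f x = 0) \<and> compact (closure {x. f x \<noteq> 0})},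
      eq = (=),
      le = (\<lambda>f g. \<forall>x. f x \<le> g x),
      vadd = (\<lambda>f g x. f x + g x),
      vzero = (\<lambda>x. 0),
      vscale = (\<lambda>c f x. c * f x)\<rparr>"

text \<open>
  In both definitions all representatives yield the same number (for \<open>f\<close> in \<open>Lip_c A\<close> and elements
  of the carriers above), which \<^const>\<open>the_elem\<close> extracts.
\<close>

definition rel_integral :: "'a measure set \<Rightarrow> ('a \<Rightarrow> real) \<Rightarrow> real" where
  "rel_integral m f = the_elem ((\<lambda>M. integral\<^sup>L M f) ` m)"

definition hat :: "'a::metric_space set \<Rightarrow> ('a \<Rightarrow> real) \<Rightarrow> ('a measure set \<times> 'a measure set) set \<Rightarrow> real" where
  "hat A f = (\<lambda>\<mu>\<in>carrier (M1_space A).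
     the_elem ((\<lambda>(m, n). rel_integral m f - rel_integral n f) ` \<mu>))"

end

theory Submission
  imports Defs "HOL-Probability.Giry_Monad"
begin

text \<open>
  A measure that is tight and locally 1-finite is determined off \<open>A\<close> by its finite values on small sets,
  the Borel subsets of compacta disjoint from \<open>A\<close>. On formal differences of such measures all
  operations and the order are computed setwise on small sets, because an additive set function on the
  small sets dominated by such a measure extends to such a measure. This gives differences and
  infima of decreasing nets, which are again computed setwise.

  If \<open>\<nu>\<^sub>i\<close> decreases to \<open>0\<close>, then \<open>\<nu>\<^sub>i E\<close> tends to \<open>0\<close> for every small \<open>E\<close>, and since the integral
  of \<open>f \<ge> 0\<close> is carried up to \<open>\<epsilon>\<close> by a small set, the integrals \<open>\<nu>\<^sub>i(f)\<close> tend to \<open>0\<close>. Lattice operations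
  are preserved because \<open>\<mu>\<close> splits into its restrictions to \<open>{g \<le> f}\<close> and its complement, and
  injectivity is tested on point masses.
\<close>

section \<open>Sums of measures\<close>

text \<open>A measure of the cone may have infinite mass, for instance near \<open>A\<close>, so
  subtracting two of them makes no sense on all Borel sets. On a compact set disjoint from
  \<open>A\<close> the distance to \<open>A\<close> is bounded below by a positive constant, and
  local 1-finiteness then forces finite mass. The order of the Grothendieck group and a null infimum
  in it are only existence statements about the cone; they become numerical once a setwise
  nonnegative difference, or the setwise infimum of a decreasing net, is known to be a measure of
  the cone again. Countable convergence theorems do not apply along a net. Directedness replaces
  them for additivity of the infimum, and domination by one member gives countable additivity. For
  the integrals one index fixes a small set outside of which all later integrals stay below
  \<epsilon>, so that only the values on this single set have to tend to zero.\<close>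

lemma sets_measure_add [simp]: "sets (measure_add M N) = sets M"
  by (simp add: measure_add_def)

lemma space_measure_add [simp]: "space (measure_add M N) = space M"
  by (simp add: measure_add_def)

lemma emeasure_measure_add:
  assumes "sets N = sets M"
  shows "emeasure (measure_add M N) E = emeasure M E + emeasure N E"
proof (cases "E \<in> sets M")
  case True
  show ?thesis
  proof (rule emeasure_measure_of)
    show "measure_add M N = measure_of (space M) (sets M) (\<lambda>E. emeasure M E + emeasure N E)"
      by (rule measure_add_def)
    show "countably_additive (sets (measure_add M N)) (\<lambda>E. emeasure M E + emeasure N E)"
    proof (rule countably_additiveI)
      fix F :: "nat \<Rightarrow> _"
      assume F: "range F \<subseteq> sets (measure_add M N)" "disjoint_family F"
      have "(\<Sum>i. emeasure M (F i) + emeasure N (F i)) = (\<Sum>i. emeasure M (F i)) + (\<Sum>i. emeasure N (F i))"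
        by (rule suminf_add[symmetric]) auto
      also have "\<dots> = emeasure M (\<Union>i. F i) + emeasure N (\<Union>i. F i)"
        using F assms by (simp add: suminf_emeasure)
      finally show "(\<Sum>i. emeasure M (F i) + emeasure N (F i)) = \<dots>" .
    qed
    show "sets M \<subseteq> Pow (space M)"
      by (rule sets.space_closed)
  qed (use True in \<open>auto simp: positive_def\<close>)
next
  case False
  then show ?thesis
    using assms by (simp add: emeasure_notin_sets)
qed

text \<open>Induction on the construction of nonnegative measurable functions. The limit step rests
  on the fact that suprema of two increasing sequences in \<open>ennreal\<close> add.\<close>

lemma nn_integral_measure_add:
  assumes "f \<in> borel_measurable M" and N: "sets N = sets M"
  shows "nn_integral (measure_add M N) f = nn_integral M f + nn_integral N f"
  using assms(1)
proof induction
  case (cong f g)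
  then show ?case
    using sets_eq_imp_space_eq[OF N] by (simp cong: nn_integral_cong_simp)
next
  case (set E)
  then show ?case
    by (simp add: emeasure_measure_add N)
next
  case (mult f c)
  have [measurable_cong]: "sets N = sets M" "sets (measure_add M N) = sets M"
    by (simp_all add: N)
  note [measurable] = mult(2)
  show ?case
    using mult by (simp add: nn_integral_cmult distrib_left)
next
  case (add f g)
  have [measurable_cong]: "sets N = sets M" "sets (measure_add M N) = sets M"
    by (simp_all add: N)
  note [measurable] = add(1,4)
  show ?case
    using add by (simp add: nn_integral_add ac_simps)
next
  case (seq U)
  have [measurable_cong]: "sets N = sets M" "sets (measure_add M N) = sets M"
    by (simp_all add: N)
  note [measurable] = seq(1)
  have *: "nn_integral L (Sup (range U)) = (SUP i. nn_integral L (U i))" if "sets L = sets M" for L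
  proof -
    have "nn_integral L (Sup (range U)) = (\<integral>\<^sup>+x. (SUP i. U i x) \<partial>L)"
      by (intro nn_integral_cong) (simp add: image_image)
    also have "\<dots> = (SUP i. nn_integral L (U i))"
    proof (rule nn_integral_monotone_convergence_SUP)
      show "incseq U"
        by (rule seq)
      show "U i \<in> borel_measurable L" for i
        unfolding measurable_cong_sets[OF that refl] by (rule seq)
    qed
    finally show ?thesis .
  qed
  have "incseq (\<lambda>i. nn_integral L (U i))" for L
    using seq(3) by (auto simp: incseq_def le_fun_def intro!: nn_integral_mono)
  then show ?case
    unfolding *[OF refl] *[OF N] *[OF sets_measure_add] seq.IH
    by (intro ennreal_SUP_add)
qed

section \<open>Radon measures relative to a closed set\<close>

text \<open>Compact subsets never exceed \<open>E\<close> by monotonicity. Exceeding every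
  \<open>c\<close> strictly below the value treats finite and infinite mass alike.\<close>

lemma rel_tightI:
  assumes M: "sets M = sets borel"
    and "\<And>E c. E \<in> sets borel \<Longrightarrow> E \<subseteq> - A \<Longrightarrow> c < emeasure M E
      \<Longrightarrow> \<exists>K. compact K \<and> K \<subseteq> E \<and> c < emeasure M K"
  shows "rel_tight A M"
  unfolding rel_tight_def
proof safe
  fix E assume E: "E \<in> sets borel" "E \<subseteq> - A"
  show "emeasure M E = (SUP K\<in>{K. compact K \<and> K \<subseteq> E}. emeasure M K)"
  proof (rule antisym)
    show "emeasure M E \<le> (SUP K\<in>{K. compact K \<and> K \<subseteq> E}. emeasure M K)"
    proof (rule dense_le)
      fix c assume "c < emeasure M E"
      then obtain K where "compact K" "K \<subseteq> E" "c < emeasure M K"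
        using assms(2) E by blast
      then show "c \<le> (SUP K\<in>{K. compact K \<and> K \<subseteq> E}. emeasure M K)"
        by (intro SUP_upper2[of K]) auto
    qed
    show "(SUP K\<in>{K. compact K \<and> K \<subseteq> E}. emeasure M K) \<le> emeasure M E"
      using E M by (auto intro!: SUP_least emeasure_mono)
  qed
qed

lemma rel_tightD:
  assumes "rel_tight A M" "E \<in> sets borel" "E \<subseteq> - A" "c < emeasure M E"
  obtains K where "compact K" "K \<subseteq> E" "c < emeasure M K"
  using assms unfolding rel_tight_def by (auto simp: less_SUP_iff)

abbreviation restr :: "'a measure \<Rightarrow> 'a set \<Rightarrow> 'a measure" where
  "restr M B \<equiv> density M (indicator B)"

lemma emeasure_restr:
  assumes "B \<in> sets M" "E \<in> sets M"
  shows "emeasure (restr M B) E = emeasure M (E \<inter> B)"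
proof -
  have "emeasure (restr M B) E = (\<integral>\<^sup>+x. indicator (E \<inter> B) x \<partial>M)"
    using assms by (subst emeasure_density) (auto intro!: nn_integral_cong simp: indicator_inter_arith mult.commute simp del: nn_integral_indicator)
  then show ?thesis
    using assms by simp
qed

lemma borel_measurable_ennreal_infdist [measurable]:
  "(\<lambda>y. ennreal (infdist y A)) \<in> borel_measurable borel"
  by (intro measurable_compose[OF _ measurable_ennreal] borel_measurable_continuous_onI continuous_intros)

text \<open>As \<open>f\<close> vanishes on \<open>A\<close>, neither integral changes when the
  measure is restricted to \<open>- A\<close>; between the restrictions the setwise comparison is an
  inequality of measures.\<close>

lemma nn_integral_mono_on_complement:
  fixes A :: "'a::topological_space set"
  assumes M: "sets M = sets borel" and N: "sets N = sets borel" and A: "closed A"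
    and le: "\<And>E. E \<in> sets borel \<Longrightarrow> E \<subseteq> - A \<Longrightarrow> emeasure M E \<le> emeasure N E"
    and f: "f \<in> borel_measurable borel" and "\<And>x. x \<in> A \<Longrightarrow> f x = 0"
  shows "(\<integral>\<^sup>+x. f x \<partial>M) \<le> (\<integral>\<^sup>+x. f x \<partial>N)"
proof -
  have A': "- A \<in> sets borel"
    using A by auto
  have *: "(\<integral>\<^sup>+x. f x \<partial>L) = (\<integral>\<^sup>+x. f x \<partial>restr L (- A))" if "sets L = sets borel" for L
  proof -
    have [measurable_cong]: "sets L = sets borel"
      by fact
    have "(\<integral>\<^sup>+x. f x \<partial>restr L (- A)) = (\<integral>\<^sup>+x. indicator (- A) x * f x \<partial>L)"
      using f A' by (subst nn_integral_density) auto
    also have "\<dots> = (\<integral>\<^sup>+x. f x \<partial>L)"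
      using assms(6) by (intro nn_integral_cong) (auto simp: indicator_def)
    finally show ?thesis ..
  qed
  have "restr M (- A) \<le> restr N (- A)"
    using M N A' le by (subst le_measure) (auto simp: emeasure_restr)
  then show ?thesis
    unfolding *[OF M] *[OF N] using M N by (intro nn_integral_mono_measure) auto
qed

locale closed_pair =
  fixes A :: "'a::metric_space set"
  assumes closed_A: "closed A" and A_nonempty: "A \<noteq> {}"
begin

lemma borel_A [measurable, simp]: "A \<in> sets borel"
  using closed_A by auto

definition radon :: "'a measure \<Rightarrow> bool" where
  "radon M \<longleftrightarrow> sets M = sets borel \<and> rel_tight A M \<and> locally_1_finite A M"

text \<open>These sets form a ring on which every Radon measure is finite, so real arithmetic is
  available there.\<close>

definition small :: "'a set \<Rightarrow> bool" where
  "small E \<longleftrightarrow> E \<in> sets borel \<and> (\<exists>K. compact K \<and> K \<subseteq> - A \<and> E \<subseteq> K)"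

lemma smallD: "small E \<Longrightarrow> E \<in> sets borel" "small E \<Longrightarrow> E \<subseteq> - A"
  by (auto simp: small_def)

lemma small_compact: "compact K \<Longrightarrow> K \<subseteq> - A \<Longrightarrow> small K"
  by (auto simp: small_def compact_imp_closed)

lemma small_subset: "small E \<Longrightarrow> F \<in> sets borel \<Longrightarrow> F \<subseteq> E \<Longrightarrow> small F"
  unfolding small_def by blast

lemma small_Un: "small E \<Longrightarrow> small F \<Longrightarrow> small (E \<union> F)"
  unfolding small_def by (metis Un_mono Un_least compact_Un sets.Un)

lemma small_empty: "small {}"
  by (intro small_compact) auto

lemma radon_sets: "radon M \<Longrightarrow> sets M = sets borel"
  by (simp add: radon_def)

lemma radon_space: "radon M \<Longrightarrow> space M = UNIV"
  using sets_eq_imp_space_eq[of M borel] by (simp add: radon_def)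

section \<open>Finite mass and inner approximation on small sets\<close>

lemma locally_1_finite_mono:
  assumes "sets M = sets borel" "sets N = sets borel" "locally_1_finite A N"
    and "\<And>E. E \<in> sets borel \<Longrightarrow> E \<subseteq> - A \<Longrightarrow> emeasure M E \<le> emeasure N E"
  shows "locally_1_finite A M"
  unfolding locally_1_finite_def
proof
  fix x
  obtain U where U: "open U" "x \<in> U" "(\<integral>\<^sup>+y\<in>U - A. ennreal (infdist y A) \<partial>N) < \<infinity>"
    using assms(3) unfolding locally_1_finite_def by blast
  have [measurable]: "U \<in> sets borel"
    using U by auto
  have "(\<integral>\<^sup>+y\<in>U - A. ennreal (infdist y A) \<partial>M) \<le> (\<integral>\<^sup>+y\<in>U - A. ennreal (infdist y A) \<partial>N)"
  proof (rule nn_integral_mono_on_complement[OF assms(1,2) closed_A assms(4)])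
    show "(\<lambda>y. ennreal (infdist y A) * indicator (U - A) y) \<in> borel_measurable borel"
      by measurable
  qed auto
  from le_less_trans[OF this U(3)] U(1,2)
  show "\<exists>U. open U \<and> x \<in> U \<and> (\<integral>\<^sup>+y\<in>U - A. ennreal (infdist y A) \<partial>M) < \<infinity>"
    by blast
qed

text \<open>Finitely many neighbourhoods given by local 1-finiteness cover \<open>K\<close>. Points
  of \<open>K\<close> in \<open>A\<close> contribute nothing because \<open>infdist\<close> vanishes
  there, so \<open>K\<close> may meet \<open>A\<close>, as the support of a function in
  \<open>Lip_c A\<close> may.\<close>

lemma nn_integral_infdist_compact:
  assumes M: "sets M = sets borel" and "locally_1_finite A M" and K: "compact K"
  shows "(\<integral>\<^sup>+y\<in>K. ennreal (infdist y A) \<partial>M) < \<infinity>"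
proof -
  have [measurable_cong]: "sets M = sets borel" by fact
  define V where "V = {U. open U \<and> (\<integral>\<^sup>+y\<in>U - A. ennreal (infdist y A) \<partial>M) < \<infinity>}"
  have "K \<subseteq> (\<Union>U\<in>V. U)"
    using assms(2) unfolding V_def locally_1_finite_def by blast
  then obtain C where C: "C \<subseteq> V" "finite C" "K \<subseteq> (\<Union>U\<in>C. U)"
    using compactE_image[OF K, of V "\<lambda>U. U"] unfolding V_def by blast
  have [measurable]: "U \<in> sets borel" if "U \<in> C" for U
    using C(1) that by (auto simp: V_def)
  have "(\<integral>\<^sup>+y\<in>K. ennreal (infdist y A) \<partial>M) \<le> (\<integral>\<^sup>+y. (\<Sum>U\<in>C. ennreal (infdist y A) * indicator (U - A) y) \<partial>M)"
  proof (rule nn_integral_mono)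
    fix y
    show "ennreal (infdist y A) * indicator K y \<le> (\<Sum>U\<in>C. ennreal (infdist y A) * indicator (U - A) y)"
    proof (cases "y \<in> K - A")
      case True
      then obtain U where "U \<in> C" "y \<in> U"
        using C by blast
      then have "ennreal (infdist y A) * indicator (U - A) y \<le> (\<Sum>U\<in>C. ennreal (infdist y A) * indicator (U - A) y)"
        using C(2) by (intro member_le_sum) auto
      with True \<open>y \<in> U\<close> show ?thesis
        by simp
    qed (auto simp: indicator_def)
  qed
  also have "\<dots> = (\<Sum>U\<in>C. (\<integral>\<^sup>+y\<in>U - A. ennreal (infdist y A) \<partial>M))"
    by (rule nn_integral_sum) measurable
  also have "\<dots> < \<infinity>"
    using C by (auto simp: V_def less_top[symmetric])
  finally show ?thesis .
qed

text \<open>Markov's inequality for the function \<open>infdist\<close>: its minimum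
  \<open>d\<close> over the enclosing compact set is positive since \<open>A\<close> is
  closed.\<close>

lemma small_finite:
  assumes M: "radon M" and E: "small E"
  shows "emeasure M E < \<infinity>"
proof -
  have [measurable_cong]: "sets M = sets borel"
    using M by (rule radon_sets)
  obtain K where K: "compact K" "K \<subseteq> - A" "E \<subseteq> K" and E': "E \<in> sets borel"
    using E by (auto simp: small_def)
  have "\<exists>d>0. \<forall>x\<in>K. d \<le> infdist x A"
  proof (cases "K = {}")
    case False
    then obtain x where x: "x \<in> K" "\<And>y. y \<in> K \<Longrightarrow> infdist x A \<le> infdist y A"
      using continuous_attains_inf[OF K(1) False continuous_on_infdist[OF continuous_on_id], of A] by auto
    moreover have "infdist x A > 0"
      using x K closed_A A_nonempty by (intro infdist_pos_not_in_closed) auto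
    ultimately show ?thesis
      by blast
  qed (auto intro: exI[of _ 1])
  then obtain d where d: "d > 0" "\<And>x. x \<in> K \<Longrightarrow> d \<le> infdist x A"
    by blast
  have K': "K \<in> sets borel"
    using K by (auto simp: compact_imp_closed)
  have "ennreal d * emeasure M E \<le> ennreal d * emeasure M K"
    using K K' M by (intro mult_left_mono emeasure_mono) (auto simp: radon_sets)
  also have "\<dots> = (\<integral>\<^sup>+y. ennreal d * indicator K y \<partial>M)"
    using K' by (subst nn_integral_cmult_indicator) (auto simp: radon_sets[OF M])
  also have "\<dots> \<le> (\<integral>\<^sup>+y\<in>K. ennreal (infdist y A) \<partial>M)"
    using d by (intro nn_integral_mono) (auto simp: indicator_def ennreal_leI)
  also have "\<dots> < \<infinity>"
    using M K by (intro nn_integral_infdist_compact) (auto simp: radon_def)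
  finally show ?thesis
    using d(1) by (auto simp: ennreal_mult_less_top)
qed

text \<open>Finite mass of \<open>E\<close> turns approximation from below into a small remainder
  \<open>E - K\<close>.\<close>

lemma radon_approx:
  assumes M: "radon M" and E: "small E" and "e > 0"
  obtains K where "compact K" "K \<subseteq> E" "emeasure M (E - K) \<le> ennreal e"
proof -
  have fin: "emeasure M E < \<infinity>"
    by (rule small_finite[OF M E])
  have SUP: "emeasure M E = (SUP K\<in>{K. compact K \<and> K \<subseteq> E}. emeasure M K)"
    using M E unfolding radon_def rel_tight_def by (auto dest: smallD)
  have "{K. compact K \<and> K \<subseteq> E} \<noteq> {}"
    by (metis (mono_tags) compact_empty empty_iff empty_subsetI mem_Collect_eq)
  then obtain K where K: "compact K" "K \<subseteq> E" "emeasure M E < emeasure M K + ennreal e"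
    using SUP_approx_ennreal[OF \<open>e > 0\<close> _ SUP] fin[THEN less_imp_neq] by blast
  have K': "K \<in> sets M" "E \<in> sets M"
    using K E M by (auto simp: compact_imp_closed radon_sets dest: smallD)
  then have "emeasure M E = emeasure M K + emeasure M (E - K)"
    using K by (subst plus_emeasure) (auto simp: Un_absorb1)
  moreover have "emeasure M K < \<infinity>"
    using small_finite[OF M small_subset[OF E _ K(2)]] K' M by (auto simp: radon_sets)
  ultimately have "emeasure M (E - K) \<le> ennreal e"
    using K(3) by (auto simp: ennreal_add_left_cancel_less)
  then show ?thesis
    using that K by blast
qed

text \<open>Any number below \<open>emeasure M E\<close> is already exceeded on a compact subset of
  \<open>E\<close>. That subset is small, so the assumed comparison applies to it.\<close>

lemma radon_le_compl:
  assumes M: "radon M" and N: "radon N"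
    and le: "\<And>E. small E \<Longrightarrow> emeasure M E \<le> emeasure N E"
    and E: "E \<in> sets borel" "E \<subseteq> - A"
  shows "emeasure M E \<le> emeasure N E"
proof (rule dense_le)
  fix c assume "c < emeasure M E"
  then obtain K where K: "compact K" "K \<subseteq> E" "c < emeasure M K"
    using M E unfolding radon_def by (meson rel_tightD)
  have "c \<le> emeasure N K"
    using K E by (meson le less_imp_le order_trans small_compact)
  also have "\<dots> \<le> emeasure N E"
    using K E N by (intro emeasure_mono) (auto simp: radon_sets)
  finally show "c \<le> emeasure N E" .
qed

lemma radon_eq_compl:
  assumes "radon M" "radon N" "\<And>E. small E \<Longrightarrow> emeasure M E = emeasure N E"
    and "E \<in> sets borel" "E \<subseteq> - A"
  shows "emeasure M E = emeasure N E"
  using radon_le_compl[OF assms(1,2) eq_refl[OF assms(3)] assms(4,5)]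
    radon_le_compl[OF assms(2,1) eq_refl[OF assms(3)[symmetric]] assms(4,5)] by (rule antisym)

section \<open>Closure properties of Radon measures\<close>

lemma radon_add:
  assumes M: "radon M" and N: "radon N"
  shows "radon (measure_add M N)"
proof -
  have [simp]: "sets M = sets borel" "sets N = sets borel"
    using M N by (simp_all add: radon_sets)
  have em: "emeasure (measure_add M N) E = emeasure M E + emeasure N E" for E
    by (simp add: emeasure_measure_add)
  have "rel_tight A (measure_add M N)"
    unfolding rel_tight_def
  proof safe
    fix E assume E: "E \<in> sets borel" "E \<subseteq> - A"
    let ?C = "{K. compact K \<and> K \<subseteq> E}"
    have "emeasure (measure_add M N) E = (SUP K\<in>?C. emeasure M K) + (SUP K\<in>?C. emeasure N K)"
      using M N E by (auto simp: em radon_def rel_tight_def)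
    \<comment> \<open>The compact subsets of \<open>E\<close> are directed under union, hence the
      two suprema can be taken jointly.\<close>
    also have "\<dots> = (SUP K\<in>?C. emeasure M K + emeasure N K)"
    proof (rule SUP_add_directed_ennreal[symmetric])
      fix i j assume "i \<in> ?C" "j \<in> ?C"
      then show "\<exists>k\<in>?C. emeasure M i + emeasure N j \<le> emeasure M k + emeasure N k"
        by (intro bexI[of _ "i \<union> j"] add_mono emeasure_mono) (auto simp: compact_imp_closed)
    qed
    finally show "emeasure (measure_add M N) E = (SUP K\<in>?C. emeasure (measure_add M N) K)"
      by (simp add: em)
  qed
  moreover have "locally_1_finite A (measure_add M N)"
    unfolding locally_1_finite_def
  proof
    fix x
    obtain U V where U: "open U" "x \<in> U" "(\<integral>\<^sup>+y\<in>U - A. ennreal (infdist y A) \<partial>M) < \<infinity>"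
      and V: "open V" "x \<in> V" "(\<integral>\<^sup>+y\<in>V - A. ennreal (infdist y A) \<partial>N) < \<infinity>"
      using M N unfolding radon_def locally_1_finite_def by meson
    have "(\<integral>\<^sup>+y\<in>(U \<inter> V) - A. ennreal (infdist y A) \<partial>measure_add M N)
      = (\<integral>\<^sup>+y\<in>(U \<inter> V) - A. ennreal (infdist y A) \<partial>M) + (\<integral>\<^sup>+y\<in>(U \<inter> V) - A. ennreal (infdist y A) \<partial>N)"
    proof (rule nn_integral_measure_add)
      have "(\<lambda>y. ennreal (infdist y A) * indicator (U \<inter> V - A) y) \<in> borel_measurable borel"
        using U V by (intro borel_measurable_times_ennreal borel_measurable_ennreal_infdist borel_measurable_indicator) auto
      then show "(\<lambda>y. ennreal (infdist y A) * indicator (U \<inter> V - A) y) \<in> borel_measurable M"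
        using measurable_cong_sets[of M borel "borel :: ennreal measure" borel] by simp
    qed simp
    also have "\<dots> \<le> (\<integral>\<^sup>+y\<in>U - A. ennreal (infdist y A) \<partial>M) + (\<integral>\<^sup>+y\<in>V - A. ennreal (infdist y A) \<partial>N)"
      by (intro add_mono nn_integral_mono) (auto simp: indicator_def)
    also have "\<dots> < \<infinity>"
      using U(3) V(3) by (metis ennreal_add_less_top infinity_ennreal_def)
    finally show "\<exists>U. open U \<and> x \<in> U \<and> (\<integral>\<^sup>+y\<in>U - A. ennreal (infdist y A) \<partial>measure_add M N) < \<infinity>"
      using open_Int[OF U(1) V(1)] U(2) V(2) by blast
  qed
  ultimately show ?thesis
    by (simp add: radon_def)
qed

lemma radon_scale:
  assumes M: "radon M" and "r < \<infinity>"
  shows "radon (scale_measure r M)"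
proof -
  have [measurable_cong]: "sets M = sets borel"
    using M by (simp_all add: radon_sets)
  have "rel_tight A (scale_measure r M)"
    using M by (auto simp: rel_tight_def radon_def SUP_mult_left_ennreal)
  moreover have "locally_1_finite A (scale_measure r M)"
    unfolding locally_1_finite_def
  proof
    fix x
    obtain U where U: "open U" "x \<in> U" "(\<integral>\<^sup>+y\<in>U - A. ennreal (infdist y A) \<partial>M) < \<infinity>"
      using M unfolding radon_def locally_1_finite_def by meson
    have [measurable]: "U \<in> sets borel"
      using U by auto
    have "(\<integral>\<^sup>+y\<in>U - A. ennreal (infdist y A) \<partial>scale_measure r M) < \<infinity>"
      using U \<open>r < \<infinity>\<close> by (subst nn_integral_scale_measure) (auto simp: ennreal_mult_less_top)
    then show "\<exists>U. open U \<and> x \<in> U \<and> (\<integral>\<^sup>+y\<in>U - A. ennreal (infdist y A) \<partial>scale_measure r M) < \<infinity>"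
      using U by blast
  qed
  ultimately show ?thesis
    using M by (simp add: radon_def)
qed

lemma radon_restr:
  assumes M: "radon M" and B: "B \<in> sets borel"
  shows "radon (restr M B)"
proof -
  have [simp]: "sets M = sets borel"
    using M by (simp_all add: radon_sets)
  have em: "emeasure (restr M B) E = emeasure M (E \<inter> B)" if "E \<in> sets borel" for E
    using B that by (simp add: emeasure_restr)
  have "rel_tight A (restr M B)"
  proof (rule rel_tightI)
    fix E c assume E: "E \<in> sets borel" "E \<subseteq> - A" "c < emeasure (restr M B) E"
    then have "c < emeasure M (E \<inter> B)"
      by (simp add: em)
    then obtain K where K: "compact K" "K \<subseteq> E \<inter> B" "c < emeasure M K"
      using rel_tightD[of A M "E \<inter> B" c] M B E unfolding radon_def by auto
    moreover have "emeasure (restr M B) K = emeasure M K"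
      using K by (simp add: em compact_imp_closed inf_absorb1)
    ultimately show "\<exists>K. compact K \<and> K \<subseteq> E \<and> c < emeasure (restr M B) K"
      by auto
  qed simp
  moreover have "locally_1_finite A (restr M B)"
  proof (rule locally_1_finite_mono)
    show "locally_1_finite A M"
      using M by (simp add: radon_def)
    show "emeasure (restr M B) E \<le> emeasure M E" if "E \<in> sets borel" for E
      using that by (simp add: em emeasure_mono)
  qed simp_all
  ultimately show ?thesis
    by (simp add: radon_def)
qed

lemma radon_null: "radon (null_measure borel)"
proof -
  have "rel_tight A (null_measure borel)"
    by (rule rel_tightI) auto
  moreover have "locally_1_finite A (null_measure borel)"
    unfolding locally_1_finite_def by (intro allI exI[of _ UNIV]) (simp add: nn_integral_null_measure)
  ultimately show ?thesis
    by (simp add: radon_def)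
qed

text \<open>The value of \<open>sup_measure'\<close> at \<open>E\<close> is the supremum of the
  masses obtained by cutting \<open>E\<close> along a Borel set \<open>Y\<close> and using
  \<open>M\<close> on one piece, \<open>N\<close> on the other. The lemma supplies the absolute
  values of the Riesz space.\<close>

lemma radon_sup:
  assumes M: "radon M" and N: "radon N"
  shows "radon (sup_measure' M N)"
proof -
  have [simp]: "sets M = sets borel" "sets N = sets borel"
    using M N by (simp_all add: radon_sets)
  let ?S = "sup_measure' M N"
  have em: "emeasure ?S E = (SUP Y\<in>sets borel. emeasure M (E \<inter> Y) + emeasure N (E \<inter> - Y))"
    if "E \<in> sets borel" for E
    using that by (simp add: emeasure_sup_measure')
  have "rel_tight A ?S"
  proof (rule rel_tightI)
    fix E c assume E: "E \<in> sets borel" "E \<subseteq> - A" "c < emeasure ?S E"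
    then obtain Y where Y: "Y \<in> sets borel" "c < emeasure M (E \<inter> Y) + emeasure N (E \<inter> - Y)"
      by (auto simp: em less_SUP_iff)
    \<comment> \<open>For one nearly optimal \<open>Y\<close> the supremum is replaced by a sum of
      restrictions, which is known to be tight and lies below \<open>?S\<close>.\<close>
    let ?L = "measure_add (restr M Y) (restr N (- Y))"
    have L: "emeasure ?L F = emeasure M (F \<inter> Y) + emeasure N (F \<inter> - Y)" if "F \<in> sets borel" for F
      using that Y by (simp add: emeasure_measure_add emeasure_restr)
    have "radon ?L"
      using M N Y by (intro radon_add radon_restr) auto
    moreover have "c < emeasure ?L E"
      using Y E by (simp add: L)
    ultimately obtain K where K: "compact K" "K \<subseteq> E" "c < emeasure ?L K"
      using rel_tightD[of A ?L E c] E unfolding radon_def by auto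
    have KB: "K \<in> sets borel"
      using K by (simp add: compact_imp_closed)
    have "emeasure ?L K \<le> emeasure ?S K"
      using Y KB by (auto simp: L em intro!: SUP_upper2[of Y])
    with K show "\<exists>K. compact K \<and> K \<subseteq> E \<and> c < emeasure ?S K"
      using order_less_le_trans by blast
  qed simp
  moreover have "locally_1_finite A ?S"
  proof (rule locally_1_finite_mono)
    show "locally_1_finite A (measure_add M N)"
      using radon_add[OF M N] by (simp add: radon_def)
    show "emeasure ?S E \<le> emeasure (measure_add M N) E" if "E \<in> sets borel" for E
      using that by (auto simp: em emeasure_measure_add intro!: SUP_least add_mono emeasure_mono)
  qed simp_all
  ultimately show ?thesis
    by (simp add: radon_def)
qed

end

section \<open>Radon measures prescribed on small sets\<close>

context closed_pair
begin

text \<open>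
  Domination by a Radon measure supplies both countable additivity and inner regularity of the
  set function \<open>\<phi>\<close>, so that it is enough to extend it by suprema over small sets.
\<close>

lemma radon_extension:
  fixes \<phi> :: "'a set \<Rightarrow> ennreal"
  assumes L: "radon L"
    and add: "\<And>E F. small E \<Longrightarrow> small F \<Longrightarrow> E \<inter> F = {} \<Longrightarrow> \<phi> (E \<union> F) = \<phi> E + \<phi> F"
    and le: "\<And>E. small E \<Longrightarrow> \<phi> E \<le> emeasure L E"
  obtains R where "radon R" "\<And>E. small E \<Longrightarrow> emeasure R E = \<phi> E"
proof -
  have sL[simp]: "sets L = sets borel"
    using L by (rule radon_sets)
  have split: "\<phi> E = \<phi> F + \<phi> (E - F)" if "small E" "F \<in> sets borel" "F \<subseteq> E" for E F
  proof -
    have "small F" "small (E - F)"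
      using small_subset[OF that(1)] that smallD(1)[OF that(1)] by auto
    from add[OF this] show ?thesis
      using that(3) by (simp add: Un_absorb1)
  qed
  have mono: "\<phi> F \<le> \<phi> E" if "small E" "F \<in> sets borel" "F \<subseteq> E" for E F
    using split[OF that] by simp
  have \<phi>0: "\<phi> {} = 0"
    using le[OF small_empty] by simp
  have fin: "\<phi> E < \<infinity>" if "small E" for E
    using le[OF that] small_finite[OF L that] by (rule le_less_trans)
  have ring: "ring_of_sets UNIV (Collect small)"
  proof (rule ring_of_setsI)
    show "a - b \<in> Collect small" if "a \<in> Collect small" "b \<in> Collect small" for a b
      using that small_subset[of a "a - b"] smallD(1) by blast
  qed (auto simp: small_empty small_Un)
  \<comment> \<open>For a finite additive set function on a ring, continuity at the empty set
    suffices. It is inherited from \<open>L\<close>, which is finite on small sets.\<close>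
  have ca: "countably_additive (Collect small) \<phi>"
  proof (rule ring_of_sets.empty_continuous_imp_countably_additive[OF ring])
    show "positive (Collect small) \<phi>"
      using \<phi>0 by (simp add: positive_def)
    show "additive (Collect small) \<phi>"
      using add by (simp add: additive_def)
    show "\<forall>A\<in>Collect small. \<phi> A \<noteq> \<infinity>"
      using fin by fastforce
    fix E :: "nat \<Rightarrow> 'a set"
    assume E: "range E \<subseteq> Collect small" "decseq E" "(\<Inter>i. E i) = {}"
    have sm: "small (E i)" for i
      using E(1) by auto
    have "(\<lambda>i. emeasure L (E i)) \<longlonglongrightarrow> emeasure L (\<Inter>i. E i)"
    proof (rule Lim_emeasure_decseq)
      show "range E \<subseteq> sets L"
        using smallD(1)[OF sm] by auto
      show "emeasure L (E i) \<noteq> \<infinity>" for i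
        using small_finite[OF L sm] less_imp_neq by blast
    qed (rule E)
    then have "(\<lambda>i. emeasure L (E i)) \<longlonglongrightarrow> 0"
      using E(3) by simp
    then show "(\<lambda>i. \<phi> (E i)) \<longlonglongrightarrow> 0"
      by (rule tendsto_sandwich[OF _ _ tendsto_const, rotated 2]) (simp_all add: le[OF sm])
  qed
  \<comment> \<open>The set \<open>- A\<close> need not be a countable union of small sets. The
    supremum over all of them still acts as a limit, since they are directed under union.\<close>
  define \<psi> where "\<psi> E = (SUP F\<in>Collect small. \<phi> (E \<inter> F))" for E
  define R where "R = measure_of UNIV (sets borel) \<psi>"
  have sm_Int: "small (E \<inter> F)" if "E \<in> sets borel" "small F" for E F
    by (rule small_subset[OF that(2) sets.Int[OF that(1) smallD(1)[OF that(2)]] Int_lower2])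
  have sR[simp]: "sets R = sets borel"
    using sets.sets_measure_of_eq[of borel \<psi>] by (simp add: R_def)
  have \<psi>_Un: "(\<Sum>n. \<psi> (E n)) = \<psi> (\<Union>n. E n)" if E: "range E \<subseteq> sets borel" "disjoint_family E" for E
  proof -
    have EB: "E n \<in> sets borel" for n
      using E by auto
    \<comment> \<open>Series and supremum may be exchanged because \<phi> is monotone along this
      directed family. For each fixed \<open>F\<close> only countable additivity on the ring
      remains.\<close>
    have "(\<Sum>n. \<psi> (E n)) = (SUP F\<in>Collect small. \<Sum>n. \<phi> (E n \<inter> F))"
      unfolding \<psi>_def
    proof (rule ennreal_suminf_SUP_eq_directed)
      fix N :: "nat set" and F G
      assume "F \<in> Collect small" "G \<in> Collect small"
      then have FG: "small F" "small G" "small (F \<union> G)"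
        by (auto intro: small_Un)
      have "\<phi> (E n \<inter> F) \<le> \<phi> (E n \<inter> (F \<union> G))" "\<phi> (E n \<inter> G) \<le> \<phi> (E n \<inter> (F \<union> G))" for n
        using FG EB by (auto intro!: mono sm_Int sets.Int dest: smallD)
      then show "\<exists>k\<in>Collect small. \<forall>n\<in>N. \<phi> (E n \<inter> F) \<le> \<phi> (E n \<inter> k) \<and> \<phi> (E n \<inter> G) \<le> \<phi> (E n \<inter> k)"
        using FG(3) by blast
    qed
    also have "\<dots> = (SUP F\<in>Collect small. \<phi> ((\<Union>n. E n) \<inter> F))"
    proof (rule SUP_cong[OF refl])
      fix F assume "F \<in> Collect small"
      then have F: "small F"
        by simp
      have "(\<Sum>n. \<phi> (E n \<inter> F)) = \<phi> (\<Union>n. E n \<inter> F)"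
      proof (rule ca[unfolded countably_additive_def, rule_format])
        show "range (\<lambda>n. E n \<inter> F) \<subseteq> Collect small"
          using sm_Int[OF EB F] by auto
        show "disjoint_family (\<lambda>n. E n \<inter> F)"
          using E(2) unfolding disjoint_family_on_def by blast
        show "(\<Union>n. E n \<inter> F) \<in> Collect small"
          using sm_Int[OF _ F, of "\<Union>n. E n"] EB by (simp add: Int_UN_distrib2)
      qed
      then show "(\<Sum>n. \<phi> (E n \<inter> F)) = \<phi> ((\<Union>n. E n) \<inter> F)"
        by (simp add: Int_UN_distrib2)
    qed
    finally show ?thesis
      by (simp add: \<psi>_def)
  qed
  have emR: "emeasure R E = \<psi> E" if "E \<in> sets borel" for E
  proof (rule emeasure_measure_of[OF R_def])
    show "positive (sets R) \<psi>"
      using \<phi>0 small_empty unfolding positive_def \<psi>_def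
      by (simp add: SUP_constant) blast
    show "countably_additive (sets R) \<psi>"
      by (rule countably_additiveI) (use \<psi>_Un in simp)
  qed (use that in auto)
  have R: "emeasure R E = \<phi> E" if E: "small E" for E
  proof -
    have "\<psi> E = \<phi> E"
      unfolding \<psi>_def
    proof (rule antisym)
      show "(SUP F\<in>Collect small. \<phi> (E \<inter> F)) \<le> \<phi> E"
        using E by (intro SUP_least mono) (auto dest: smallD)
      show "\<phi> E \<le> (SUP F\<in>Collect small. \<phi> (E \<inter> F))"
        using E by (intro SUP_upper2[of E]) auto
    qed
    then show ?thesis
      using emR smallD(1)[OF E] by simp
  qed
  have "rel_tight A R"
  proof (rule rel_tightI)
    fix E c assume E: "E \<in> sets borel" "E \<subseteq> - A" "c < emeasure R E"
    then obtain F where F: "small F" "c < \<phi> (E \<inter> F)"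
      by (auto simp: emR \<psi>_def less_SUP_iff)
    let ?G = "E \<inter> F"
    have G: "small ?G"
      using E F by (auto intro: sm_Int)
    obtain g where g: "\<phi> ?G = ennreal g" "0 \<le> g"
      using fin[OF G] by (cases "\<phi> ?G") auto
    obtain d where d: "c = ennreal d" "0 \<le> d"
      using F(2) g by (cases c) auto
    have dg: "d < g"
      using F(2) g d by (simp add: ennreal_less_iff)
    \<comment> \<open>The remainder has \<phi>-value at most its \<open>L\<close>-mass. Allowing
      half of the gap \<open>g - d\<close> keeps the \<phi>-value of \<open>K\<close> strictly above
      \<open>d\<close>.\<close>
    then obtain K where K: "compact K" "K \<subseteq> ?G" "emeasure L (?G - K) \<le> ennreal ((g - d) / 2)"
      using radon_approx[OF L G, of "(g - d) / 2"] by auto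
    have KB: "K \<in> sets borel"
      using K by (simp add: compact_imp_closed)
    have sm: "small K" "small (?G - K)"
      using small_subset[OF G KB K(2)] small_subset[OF G sets.Diff[OF smallD(1)[OF G] KB] Diff_subset]
      by blast+
    have "c < \<phi> K"
    proof (rule ccontr)
      assume "\<not> c < \<phi> K"
      then have "\<phi> ?G \<le> c + ennreal ((g - d) / 2)"
        unfolding split[OF G KB K(2)] using order_trans[OF le[OF sm(2)] K(3)] by (intro add_mono) auto
      also have "\<dots> = ennreal (d + (g - d) / 2)"
        using d dg by (simp add: ennreal_plus)
      finally have "g \<le> d + (g - d) / 2"
        unfolding g(1) using d dg by (subst (asm) ennreal_le_iff) auto
      then show False
        using dg by (simp add: field_simps)
    qed
    then show "\<exists>K. compact K \<and> K \<subseteq> E \<and> c < emeasure R K"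
      using K R[OF sm(1)] by auto
  qed simp
  moreover have "locally_1_finite A R"
  proof (rule locally_1_finite_mono)
    show "locally_1_finite A L"
      using L by (simp add: radon_def)
    show "emeasure R E \<le> emeasure L E" if "E \<in> sets borel" for E
      unfolding emR[OF that] \<psi>_def
    proof (rule SUP_least)
      fix F assume "F \<in> Collect small"
      then have "\<phi> (E \<inter> F) \<le> emeasure L (E \<inter> F)"
        using that by (intro le sm_Int) auto
      also have "\<dots> \<le> emeasure L E"
        using that by (intro emeasure_mono) auto
      finally show "\<phi> (E \<inter> F) \<le> emeasure L E" .
    qed
  qed simp_all
  ultimately have "radon R"
    by (simp add: radon_def)
  with R show ?thesis
    using that by blast
qed

lemma emeasure_small_Un:
  assumes "radon M" "small E" "small F" "E \<inter> F = {}"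
  shows "emeasure M (E \<union> F) = emeasure M E + emeasure M F"
  using assms smallD(1) by (intro plus_emeasure[symmetric]) (auto simp: radon_sets)

text \<open>The setwise difference is additive on small sets and dominated by \<open>M\<close>, so
  it extends to a Radon measure. This provides the cone element that the order of the Grothendieck
  group asks for.\<close>

lemma radon_diff:
  assumes M: "radon M" and N: "radon N" and le: "\<And>E. small E \<Longrightarrow> emeasure N E \<le> emeasure M E"
  obtains R where "radon R" "\<And>E. small E \<Longrightarrow> emeasure M E = emeasure N E + emeasure R E"
proof -
  have sum: "emeasure M E = emeasure N E + (emeasure M E - emeasure N E)" if "small E" for E
    by (rule ennreal_ineq_diff_add[OF le[OF that]])
  obtain R where R: "radon R" "\<And>E. small E \<Longrightarrow> emeasure R E = emeasure M E - emeasure N E"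
  proof (rule radon_extension[OF M])
    fix E F assume EF: "small E" "small F" "E \<inter> F = {}"
    \<comment> \<open>Truncated subtraction does not distribute over sums, so additivity is checked
      after adding the values of \<open>N\<close>, which are finite and cancel.\<close>
    have "emeasure N E + emeasure N F + (emeasure M (E \<union> F) - emeasure N (E \<union> F)) = emeasure M (E \<union> F)"
      using sum[OF small_Un[OF EF(1,2)]] emeasure_small_Un[OF N EF] by simp
    also have "\<dots> = (emeasure N E + (emeasure M E - emeasure N E)) + (emeasure N F + (emeasure M F - emeasure N F))"
      using sum[OF EF(1)] sum[OF EF(2)] emeasure_small_Un[OF M EF] by simp
    also have "\<dots> = emeasure N E + emeasure N F + ((emeasure M E - emeasure N E) + (emeasure M F - emeasure N F))"
      by (simp add: ac_simps)
    finally have "emeasure N E + emeasure N F + (emeasure M (E \<union> F) - emeasure N (E \<union> F)) = \<dots>" .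
    moreover have "emeasure N E + emeasure N F < \<infinity>"
      using small_finite[OF N EF(1)] small_finite[OF N EF(2)] by simp
    ultimately show "emeasure M (E \<union> F) - emeasure N (E \<union> F)
      = (emeasure M E - emeasure N E) + (emeasure M F - emeasure N F)"
      using ennreal_add_left_cancel less_imp_neq by blast
  qed (auto intro: diff_le_self_ennreal that)
  then show ?thesis
    using that sum by metis
qed

text \<open>The infimum is superadditive for any family. The reverse inequality is where
  \<open>dir\<close> enters: one member \<open>k\<close> lies below both a nearly optimal
  \<open>i\<close> for \<open>E\<close> and a nearly optimal \<open>j\<close> for \<open>F\<close>.
  Any member dominates the infimum.\<close>

lemma radon_INF:
  assumes "I \<noteq> {}" and \<nu>: "\<And>i. i \<in> I \<Longrightarrow> radon (\<nu> i)"
    and dir: "\<And>i j. i \<in> I \<Longrightarrow> j \<in> I \<Longrightarrow> \<exists>k\<in>I. \<forall>E. small E \<longrightarrow>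
      emeasure (\<nu> k) E \<le> emeasure (\<nu> i) E \<and> emeasure (\<nu> k) E \<le> emeasure (\<nu> j) E"
  obtains R where "radon R" "\<And>E. small E \<Longrightarrow> emeasure R E = (INF i\<in>I. emeasure (\<nu> i) E)"
proof -
  obtain i0 where i0: "i0 \<in> I"
    using assms(1) by blast
  show ?thesis
  proof (rule radon_extension[OF \<nu>[OF i0]])
    fix E F assume EF: "small E" "small F" "E \<inter> F = {}"
    let ?\<phi> = "\<lambda>E. INF i\<in>I. emeasure (\<nu> i) E"
    show "?\<phi> (E \<union> F) = ?\<phi> E + ?\<phi> F"
    proof (rule antisym)
      show "?\<phi> E + ?\<phi> F \<le> ?\<phi> (E \<union> F)"
        using \<nu> EF by (intro INF_greatest) (auto simp: emeasure_small_Un intro!: add_mono INF_lower)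
      show "?\<phi> (E \<union> F) \<le> ?\<phi> E + ?\<phi> F"
      proof (rule ennreal_le_epsilon)
        fix e :: real
        assume top: "?\<phi> E + ?\<phi> F < Orderings.top" and e: "0 < e"
        have "x < x + ennreal (e / 2)" if "x < Orderings.top" for x
          using that e by (cases x) auto
        with top have "?\<phi> E < ?\<phi> E + ennreal (e / 2)" "?\<phi> F < ?\<phi> F + ennreal (e / 2)"
          unfolding ennreal_add_less_top by blast+
        then obtain i j where ij: "i \<in> I" "j \<in> I" "emeasure (\<nu> i) E < ?\<phi> E + ennreal (e / 2)"
          "emeasure (\<nu> j) F < ?\<phi> F + ennreal (e / 2)"
          by (auto simp: INF_less_iff)
        obtain k where k: "k \<in> I" "emeasure (\<nu> k) E \<le> emeasure (\<nu> i) E" "emeasure (\<nu> k) F \<le> emeasure (\<nu> j) F"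
          using dir[OF ij(1,2)] EF by blast
        have "?\<phi> (E \<union> F) \<le> emeasure (\<nu> k) E + emeasure (\<nu> k) F"
          using k(1) \<nu> EF by (intro INF_lower2[of k]) (auto simp: emeasure_small_Un)
        also have "\<dots> \<le> (?\<phi> E + ennreal (e / 2)) + (?\<phi> F + ennreal (e / 2))"
          using k ij by (intro add_mono) auto
        also have "\<dots> = ?\<phi> E + ?\<phi> F + (ennreal (e / 2) + ennreal (e / 2))"
          by (simp add: ac_simps)
        also have "ennreal (e / 2) + ennreal (e / 2) = ennreal e"
          using e by (simp flip: ennreal_plus)
        finally show "?\<phi> (E \<union> F) \<le> ?\<phi> E + ?\<phi> F + ennreal e" .
      qed
    qed
  qed (use i0 that in \<open>auto intro: INF_lower\<close>)
qed

end

section \<open>Representatives of the classes in the quotients\<close>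

context closed_pair
begin

definition agree :: "'a measure \<Rightarrow> 'a measure \<Rightarrow> bool" where
  "agree M N \<longleftrightarrow> (\<forall>E\<in>sets borel. E \<subseteq> - A \<longrightarrow> emeasure M E = emeasure N E)"

lemma agree_refl: "agree M M"
  by (simp add: agree_def)

abbreviation quot_rel :: "('a measure \<times> 'a measure) set" where
  "quot_rel \<equiv> monoid_quot_rel borel_measures (borel_measures_on A)"

definition cls :: "'a measure \<Rightarrow> 'a measure set" where
  "cls M = quot_rel `` {M}"

text \<open>Measures on \<open>A\<close> add nothing off \<open>A\<close>, which gives one
  direction. For the other, each measure receives the restriction of the other one to
  \<open>A\<close>: both sums are then \<open>M + N\<close> on \<open>A\<close> and have the common
  value off \<open>A\<close>. Nothing is subtracted, so infinite mass is harmless.\<close>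

lemma quot_rel_iff:
  "(M, N) \<in> quot_rel \<longleftrightarrow> sets M = sets borel \<and> sets N = sets borel \<and> agree M N"
proof
  assume "(M, N) \<in> quot_rel"
  then obtain S T where S: "sets S = sets borel" "emeasure S (- A) = 0"
    and T: "sets T = sets borel" "emeasure T (- A) = 0"
    and MN: "sets M = sets borel" "sets N = sets borel" and eq: "measure_add M S = measure_add N T"
    by (auto simp: monoid_quot_rel_def borel_measures_on_def borel_measures_def)
  have "agree M N"
    unfolding agree_def
  proof safe
    fix E assume E: "E \<in> sets borel" "E \<subseteq> - A"
    have "emeasure S E = 0" "emeasure T E = 0"
      using emeasure_mono[OF E(2), of S] emeasure_mono[OF E(2), of T] S T by auto
    moreover have "emeasure M E + emeasure S E = emeasure N E + emeasure T E"
      using arg_cong[OF eq, of "\<lambda>L. emeasure L E"] S T MN by (simp add: emeasure_measure_add)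
    ultimately show "emeasure M E = emeasure N E"
      by simp
  qed
  with MN show "sets M = sets borel \<and> sets N = sets borel \<and> agree M N"
    by blast
next
  assume "sets M = sets borel \<and> sets N = sets borel \<and> agree M N"
  then have MN[simp]: "sets M = sets borel" "sets N = sets borel" and ag: "agree M N"
    by blast+
  have "restr L A \<in> borel_measures_on A" if "sets L = sets borel" for L
    using that by (auto simp: borel_measures_on_def borel_measures_def emeasure_restr)
  moreover have "measure_add M (restr N A) = measure_add N (restr M A)"
  proof (rule measure_eqI)
    fix E assume "E \<in> sets (measure_add M (restr N A))"
    then have E: "E \<in> sets borel"
      by simp
    have sp: "emeasure L E = emeasure L (E \<inter> A) + emeasure L (E - A)" if "sets L = sets borel" for L
    proof -
      have "emeasure L (E \<inter> A) + emeasure L (E - A) = emeasure L (E \<inter> A \<union> (E - A))"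
        using E that by (intro plus_emeasure) auto
      also have "E \<inter> A \<union> (E - A) = E"
        by blast
      finally show ?thesis ..
    qed
    have "emeasure M (E - A) = emeasure N (E - A)"
      using ag E by (auto simp: agree_def)
    then show "emeasure (measure_add M (restr N A)) E = emeasure (measure_add N (restr M A)) E"
      using E by (simp add: emeasure_measure_add emeasure_restr sp[of M] sp[of N] ac_simps)
  qed simp
  ultimately show "(M, N) \<in> quot_rel"
    unfolding monoid_quot_rel_def by (force simp: borel_measures_def)
qed

lemma mem_cls_iff: "N \<in> cls M \<longleftrightarrow> sets M = sets borel \<and> sets N = sets borel \<and> agree M N"
  by (simp add: cls_def quot_rel_iff)

lemma self_mem_cls: "sets M = sets borel \<Longrightarrow> M \<in> cls M"
  by (simp add: mem_cls_iff agree_refl)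

lemma cls_eq_iff:
  assumes "sets M = sets borel" "sets N = sets borel"
  shows "cls M = cls N \<longleftrightarrow> agree M N"
proof
  show "agree M N" if "cls M = cls N"
    using self_mem_cls[OF assms(2)] that mem_cls_iff by blast
  show "cls M = cls N" if "agree M N"
    using assms that by (auto simp: mem_cls_iff agree_def)
qed

text \<open>Operations on classes are unions over representatives; such a union collapses once all
  representatives give the same class.\<close>

lemma UN_const: "x \<in> X \<Longrightarrow> (\<And>y. y \<in> X \<Longrightarrow> f y = c) \<Longrightarrow> (\<Union>y\<in>X. f y) = c"
  by auto

lemma mult_cls:
  assumes [simp]: "sets M = sets borel" "sets N = sets borel"
  shows "cls M \<otimes>\<^bsub>M1_cone A\<^esub> cls N = cls (measure_add M N)"
proof -
  have "(\<Union>x\<in>cls M. \<Union>y\<in>cls N. cls (measure_add x y)) = cls (measure_add M N)"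
  proof (intro UN_const)
    fix x y assume "x \<in> cls M" "y \<in> cls N"
    then show "cls (measure_add x y) = cls (measure_add M N)"
      by (subst cls_eq_iff) (auto simp: mem_cls_iff agree_def emeasure_measure_add)
  qed (rule self_mem_cls, simp)+
  then show ?thesis
    by (simp add: M1_cone_def rel_borel_measures_def monoid_quot_def borel_measures_def cls_def)
qed

lemma one_M1_cone: "\<one>\<^bsub>M1_cone A\<^esub> = cls (null_measure borel)"
  by (simp add: M1_cone_def rel_borel_measures_def monoid_quot_def borel_measures_def cls_def)

lemma cscale_cls:
  assumes [simp]: "sets M = sets borel"
  shows "cscale (M1_cone A) c (cls M) = cls (scale_measure (ennreal c) M)"
proof -
  have "(\<Union>x\<in>cls M. cls (scale_measure (ennreal c) x)) = cls (scale_measure (ennreal c) M)"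
  proof (rule UN_const)
    fix x assume "x \<in> cls M"
    then show "cls (scale_measure (ennreal c) x) = cls (scale_measure (ennreal c) M)"
      by (subst cls_eq_iff) (auto simp: mem_cls_iff agree_def)
  qed (rule self_mem_cls, simp)
  then show ?thesis
    by (simp add: M1_cone_def cls_def)
qed

lemma carrier_M1_cone: "carrier (M1_cone A) = cls ` {M. radon M}"
proof safe
  fix m assume "m \<in> carrier (M1_cone A)"
  then obtain M N where "m = cls M" "N \<in> m" "rel_tight A N" "locally_1_finite A N"
    unfolding M1_cone_def rel_borel_measures_def monoid_quot_def cls_def quotient_def by auto
  then have "m = cls N" "radon N"
    by (auto simp: mem_cls_iff cls_eq_iff radon_def)
  then show "m \<in> cls ` {M. radon M}"
    by blast
next
  fix M assume M: "radon M"
  have "M \<in> cls M"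
    using M by (simp add: self_mem_cls radon_sets)
  then show "cls M \<in> carrier (M1_cone A)"
    using M unfolding M1_cone_def rel_borel_measures_def monoid_quot_def
    by (auto simp: borel_measures_def cls_def radon_def intro!: quotientI)
qed

section \<open>Formal differences as set functions on small sets\<close>

definition dif :: "'a measure \<Rightarrow> 'a measure \<Rightarrow> 'a set \<Rightarrow> real" where
  "dif M N E = measure M E - measure N E"

lemma dif_null_right: "dif M (null_measure borel) E = measure M E"
  by (simp add: dif_def)

definition el :: "'a measure \<Rightarrow> 'a measure \<Rightarrow> ('a measure set \<times> 'a measure set) set" where
  "el M N = groth_rel (M1_cone A) `` {(cls M, cls N)}"

text \<open>\<open>measure\<close> sends infinite mass to 0; finiteness on small sets makes the
  passage to real numbers faithful.\<close>

lemma emeasure_small: "radon M \<Longrightarrow> small E \<Longrightarrow> emeasure M E = ennreal (measure M E)"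
  using small_finite[of M E] by (intro emeasure_eq_ennreal_measure) auto

lemma measure_add_small:
  assumes "radon M" "radon N" "small E"
  shows "measure (measure_add M N) E = measure M E + measure N E"
proof -
  have "ennreal (measure (measure_add M N) E) = ennreal (measure M E + measure N E)"
    using assms radon_add[OF assms(1,2)]
    by (simp add: emeasure_small[symmetric] emeasure_measure_add radon_sets)
  then show ?thesis
    by (subst (asm) ennreal_inj) auto
qed

lemma agree_radon_iff:
  assumes M: "radon M" and N: "radon N"
  shows "agree M N \<longleftrightarrow> (\<forall>E. small E \<longrightarrow> measure M E = measure N E)"
proof
  show "\<forall>E. small E \<longrightarrow> measure M E = measure N E" if "agree M N"
    using that smallD unfolding agree_def measure_def by metis
  show "agree M N" if "\<forall>E. small E \<longrightarrow> measure M E = measure N E"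
    unfolding agree_def
  proof (intro ballI impI)
    show "emeasure M E = emeasure N E" if E: "E \<in> sets borel" "E \<subseteq> - A" for E
    proof (rule radon_eq_compl[OF M N _ E])
      show "emeasure M E = emeasure N E" if "small E" for E
        using that \<open>\<forall>E. small E \<longrightarrow> measure M E = measure N E\<close> by (simp add: emeasure_small M N)
    qed
  qed
qed

text \<open>The extra summand in the Grothendieck relation cancels because its values on small sets
  are finite real numbers. Conversely the null measure serves as that summand.\<close>

lemma groth_rel_cls_iff:
  assumes M: "radon M" and N: "radon N" and P: "radon P" and Q: "radon Q"
  shows "((cls M, cls N), (cls P, cls Q)) \<in> groth_rel (M1_cone A)
    \<longleftrightarrow> (\<forall>E. small E \<longrightarrow> dif M N E = dif P Q E)"
proof -
  note [simp] = M N P Q radon_sets radon_add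
  have eq: "(cls M \<otimes>\<^bsub>M1_cone A\<^esub> cls Q) \<otimes>\<^bsub>M1_cone A\<^esub> cls K = (cls P \<otimes>\<^bsub>M1_cone A\<^esub> cls N) \<otimes>\<^bsub>M1_cone A\<^esub> cls K
      \<longleftrightarrow> (\<forall>E. small E \<longrightarrow> dif M N E = dif P Q E)" if "radon K" for K
    using that by (auto simp: mult_cls cls_eq_iff agree_radon_iff measure_add_small dif_def algebra_simps)
  show ?thesis
    using eq radon_null by (auto simp: groth_rel_def carrier_M1_cone)
qed

lemma mem_el_iff:
  assumes "radon M" "radon N"
  shows "p \<in> el M N \<longleftrightarrow>
    (\<exists>P Q. radon P \<and> radon Q \<and> p = (cls P, cls Q) \<and> (\<forall>E. small E \<longrightarrow> dif M N E = dif P Q E))"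
    (is "_ \<longleftrightarrow> ?R")
proof
  assume p: "p \<in> el M N"
  then obtain P Q where "radon P" "radon Q" "p = (cls P, cls Q)"
    unfolding el_def groth_rel_def carrier_M1_cone by auto
  with p assms show ?R
    unfolding el_def using groth_rel_cls_iff by blast
next
  assume ?R
  then show "p \<in> el M N"
    unfolding el_def using groth_rel_cls_iff assms by blast
qed

lemma self_mem_el: "radon M \<Longrightarrow> radon N \<Longrightarrow> (cls M, cls N) \<in> el M N"
  using mem_el_iff by blast

lemma el_eq_iff:
  assumes "radon M" "radon N" "radon P" "radon Q"
  shows "el M N = el P Q \<longleftrightarrow> (\<forall>E. small E \<longrightarrow> dif M N E = dif P Q E)"
proof
  show "\<forall>E. small E \<longrightarrow> dif M N E = dif P Q E" if "el M N = el P Q"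
    using self_mem_el[OF assms(3,4)] that groth_rel_cls_iff[OF assms] unfolding el_def by blast
  show "el M N = el P Q" if "\<forall>E. small E \<longrightarrow> dif M N E = dif P Q E"
    using that by (intro Set.set_eqI) (simp add: mem_el_iff assms)
qed

lemma carrier_M1_space: "carrier (M1_space A) = {el M N |M N. radon M \<and> radon N}"
  by (auto simp: M1_space_def grothendieck_def quotient_def carrier_M1_cone el_def)

lemma el_carrier: "radon M \<Longrightarrow> radon N \<Longrightarrow> el M N \<in> carrier (M1_space A)"
  using carrier_M1_space by blast

lemma vzero_M1_space: "vzero (M1_space A) = el (null_measure borel) (null_measure borel)"
  by (simp add: M1_space_def grothendieck_def one_M1_cone el_def)

lemma dif_add:
  assumes "radon M" "radon N" "radon P" "radon Q" "small E"
  shows "dif (measure_add M P) (measure_add N Q) E = dif M N E + dif P Q E"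
  using assms by (simp add: dif_def measure_add_small)

lemma vadd_el:
  assumes M: "radon M" and N: "radon N" and P: "radon P" and Q: "radon Q"
  shows "vadd (M1_space A) (el M N) (el P Q) = el (measure_add M P) (measure_add N Q)"
proof -
  let ?C = "M1_cone A"
  have "(\<Union>x\<in>el M N. \<Union>y\<in>el P Q. groth_rel ?C `` {(fst x \<otimes>\<^bsub>?C\<^esub> fst y, snd x \<otimes>\<^bsub>?C\<^esub> snd y)})
    = el (measure_add M P) (measure_add N Q)"
  proof (intro UN_const)
    fix x y assume "x \<in> el M N" "y \<in> el P Q"
    then obtain M' N' P' Q' where *: "radon M'" "radon N'" "radon P'" "radon Q'"
      "x = (cls M', cls N')" "y = (cls P', cls Q')"
      "\<forall>E. small E \<longrightarrow> dif M N E = dif M' N' E" "\<forall>E. small E \<longrightarrow> dif P Q E = dif P' Q' E"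
      unfolding mem_el_iff[OF M N] mem_el_iff[OF P Q] by blast
    have "groth_rel ?C `` {(fst x \<otimes>\<^bsub>?C\<^esub> fst y, snd x \<otimes>\<^bsub>?C\<^esub> snd y)} = el (measure_add M' P') (measure_add N' Q')"
      using * by (simp add: el_def mult_cls radon_sets)
    also have "\<dots> = el (measure_add M P) (measure_add N Q)"
      using * assms by (simp add: el_eq_iff radon_add dif_add)
    finally show "groth_rel ?C `` {(fst x \<otimes>\<^bsub>?C\<^esub> fst y, snd x \<otimes>\<^bsub>?C\<^esub> snd y)} = \<dots>" .
  qed (rule self_mem_el[OF M N] self_mem_el[OF P Q])+
  then show ?thesis
    by (simp add: M1_space_def grothendieck_def groth_add_def case_prod_unfold)
qed

lemma dif_scale:
  assumes "0 \<le> r"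
  shows "dif (scale_measure (ennreal r) M) (scale_measure (ennreal r) N) E = r * dif M N E"
  using assms by (simp add: dif_def algebra_simps measure_def enn2real_mult)

lemma vscale_el:
  assumes M: "radon M" and N: "radon N"
  shows "vscale (M1_space A) r (el M N) =
    (if 0 \<le> r then el (scale_measure (ennreal r) M) (scale_measure (ennreal r) N)
     else el (scale_measure (ennreal (- r)) N) (scale_measure (ennreal (- r)) M))"
proof -
  let ?C = "M1_cone A"
  have "(\<Union>x\<in>el M N. groth_rel ?C `` {if 0 \<le> r then (cscale ?C r (fst x), cscale ?C r (snd x))
      else (cscale ?C (- r) (snd x), cscale ?C (- r) (fst x))}) =
    (if 0 \<le> r then el (scale_measure (ennreal r) M) (scale_measure (ennreal r) N)
     else el (scale_measure (ennreal (- r)) N) (scale_measure (ennreal (- r)) M))" (is "(\<Union>x\<in>_. ?f x) = ?r")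
  proof (intro UN_const)
    fix x assume "x \<in> el M N"
    then obtain M' N' where *: "radon M'" "radon N'" "x = (cls M', cls N')"
      "\<forall>E. small E \<longrightarrow> dif M N E = dif M' N' E"
      unfolding mem_el_iff[OF M N] by blast
    have "dif N M E = dif N' M' E" if "small E" for E
      using *(4) that by (simp add: dif_def algebra_simps)
    with * show "?f x = ?r"
      using assms by (auto simp: cscale_cls radon_sets el_def[symmetric] el_eq_iff radon_scale dif_scale)
  qed (rule self_mem_el, fact, fact)
  then show ?thesis
    by (simp add: M1_space_def grothendieck_def groth_scale_def case_prod_unfold)
qed

lemma le_el_iff_ex:
  assumes M: "radon M" and N: "radon N" and P: "radon P" and Q: "radon Q"
  shows "el M N \<sqsubseteq>\<^bsub>M1_space A\<^esub> el P Q \<longleftrightarrow>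
    (\<exists>R. radon R \<and> (\<forall>E. small E \<longrightarrow> dif P Q E = dif M N E + measure R E))"
proof -
  have "el M N \<sqsubseteq>\<^bsub>M1_space A\<^esub> el P Q \<longleftrightarrow>
    (\<exists>R. radon R \<and> el P Q = vadd (M1_space A) (el M N) (el R (null_measure borel)))"
    by (auto simp: M1_space_def grothendieck_def carrier_M1_cone one_M1_cone el_def)
  also have "\<dots> \<longleftrightarrow> (\<exists>R. radon R \<and> (\<forall>E. small E \<longrightarrow> dif P Q E = dif M N E + measure R E))"
    by (intro ex_cong1 conj_cong refl)
      (simp add: assms vadd_el radon_null el_eq_iff radon_add dif_add dif_null_right)
  finally show ?thesis .
qed

text \<open>For the direction from right to left the inequality is rearranged to
  \<open>M + Q\<close> below \<open>P + N\<close>, a comparison of measures, to which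
  \<open>radon_diff\<close> applies.\<close>

lemma le_el_iff:
  assumes M: "radon M" and N: "radon N" and P: "radon P" and Q: "radon Q"
  shows "el M N \<sqsubseteq>\<^bsub>M1_space A\<^esub> el P Q \<longleftrightarrow> (\<forall>E. small E \<longrightarrow> dif M N E \<le> dif P Q E)"
  unfolding le_el_iff_ex[OF assms]
proof safe
  fix R E assume "\<forall>E. small E \<longrightarrow> dif P Q E = dif M N E + measure R E" "small E"
  then show "dif M N E \<le> dif P Q E"
    by simp
next
  assume le: "\<forall>E. small E \<longrightarrow> dif M N E \<le> dif P Q E"
  have "emeasure (measure_add M Q) E \<le> emeasure (measure_add P N) E" if "small E" for E
    using le that assms
    by (auto simp: emeasure_small radon_add measure_add_small dif_def algebra_simps
        simp del: ennreal_plus intro!: ennreal_leI)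
  then obtain R where R: "radon R"
    "\<And>E. small E \<Longrightarrow> emeasure (measure_add P N) E = emeasure (measure_add M Q) E + emeasure R E"
    using radon_diff[OF radon_add[OF P N] radon_add[OF M Q]] by metis
  have "dif P Q E = dif M N E + measure R E" if E: "small E" for E
  proof -
    have "ennreal (measure P E + measure N E) = ennreal (measure M E + measure Q E + measure R E)"
      using R(2)[OF E] E R(1) assms
      by (simp add: emeasure_measure_add radon_sets emeasure_small)
    then have "measure P E + measure N E = measure M E + measure Q E + measure R E"
      by (subst (asm) ennreal_inj) auto
    then show ?thesis
      by (simp add: dif_def)
  qed
  with R(1) show "\<exists>R. radon R \<and> (\<forall>E. small E \<longrightarrow> dif P Q E = dif M N E + measure R E)"
    by blast
qed

end

section \<open>Integrals of Lipschitz functions\<close>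

lemma integrable_measure_add:
  fixes f :: "'a \<Rightarrow> real"
  assumes "integrable M f" "integrable N f" and N: "sets N = sets M"
  shows "integrable (measure_add M N) f"
    and "integral\<^sup>L (measure_add M N) f = integral\<^sup>L M f + integral\<^sup>L N f"
proof -
  have f: "f \<in> borel_measurable M"
    using assms(1) by simp
  \<comment> \<open>The function \<open>h\<close> will be the norm, for integrability, and the
    identity and negation, for the positive and negative part.\<close>
  have nn: "(\<integral>\<^sup>+x. ennreal (h (f x)) \<partial>measure_add M N) = (\<integral>\<^sup>+x. ennreal (h (f x)) \<partial>M) + (\<integral>\<^sup>+x. ennreal (h (f x)) \<partial>N)"
    if "h \<in> borel_measurable borel" for h
    using measurable_compose[OF measurable_compose[OF f that] measurable_ennreal] N
    by (rule nn_integral_measure_add)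
  have "(\<integral>\<^sup>+x. ennreal (norm (f x)) \<partial>measure_add M N) < \<infinity>"
    unfolding nn[OF borel_measurable_norm]
    using assms(1,2) by (simp add: integrable_iff_bounded)
  then show *: "integrable (measure_add M N) f"
    using f measurable_cong_sets[OF sets_measure_add refl, of M N "borel :: real measure"]
    by (intro integrableI_bounded) auto
  have nn1: "(\<integral>\<^sup>+x. ennreal (f x) \<partial>measure_add M N) = (\<integral>\<^sup>+x. ennreal (f x) \<partial>M) + (\<integral>\<^sup>+x. ennreal (f x) \<partial>N)"
    and nn2: "(\<integral>\<^sup>+x. ennreal (- f x) \<partial>measure_add M N) = (\<integral>\<^sup>+x. ennreal (- f x) \<partial>M) + (\<integral>\<^sup>+x. ennreal (- f x) \<partial>N)"
    using nn[of "\<lambda>x. x"] nn[of uminus] by simp_all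
  have fin: "(\<integral>\<^sup>+x. ennreal (f x) \<partial>L) < Orderings.top" "(\<integral>\<^sup>+x. ennreal (- f x) \<partial>L) < Orderings.top" if "integrable L f" for L
    using integrableD(2)[OF that] integrableD(3)[OF that] by (simp_all add: less_top)
  show "integral\<^sup>L (measure_add M N) f = integral\<^sup>L M f + integral\<^sup>L N f"
    unfolding real_lebesgue_integral_def[OF *] real_lebesgue_integral_def[OF assms(1)]
      real_lebesgue_integral_def[OF assms(2)] nn1 nn2
    using fin[OF assms(1)] fin[OF assms(2)] by (simp add: enn2real_plus)
qed

lemma integral_scale_measure:
  fixes f :: "'a \<Rightarrow> real"
  assumes f: "integrable M f" and r: "0 \<le> r"
  shows "integral\<^sup>L (scale_measure (ennreal r) M) f = r * integral\<^sup>L M f"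
proof -
  have nn: "(\<integral>\<^sup>+x. ennreal (h (f x)) \<partial>scale_measure (ennreal r) M) = ennreal r * (\<integral>\<^sup>+x. ennreal (h (f x)) \<partial>M)"
    if "h \<in> borel_measurable borel" for h
    using measurable_compose[OF measurable_compose[OF borel_measurable_integrable[OF f] that] measurable_ennreal]
    by (rule nn_integral_scale_measure)
  have "(\<integral>\<^sup>+x. ennreal (norm (f x)) \<partial>scale_measure (ennreal r) M) < \<infinity>"
    unfolding nn[OF borel_measurable_norm]
    using f by (simp add: integrable_iff_bounded ennreal_mult_less_top)
  then have *: "integrable (scale_measure (ennreal r) M) f"
    using f measurable_cong_sets[OF sets_scale_measure refl, of "ennreal r" M "borel :: real measure"]
    by (intro integrableI_bounded) auto
  have "(\<integral>\<^sup>+x. ennreal (f x) \<partial>scale_measure (ennreal r) M) = ennreal r * (\<integral>\<^sup>+x. ennreal (f x) \<partial>M)"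
    "(\<integral>\<^sup>+x. ennreal (- f x) \<partial>scale_measure (ennreal r) M) = ennreal r * (\<integral>\<^sup>+x. ennreal (- f x) \<partial>M)"
    using nn[of "\<lambda>x. x"] nn[of uminus] by simp_all
  then show ?thesis
    unfolding real_lebesgue_integral_def[OF *] real_lebesgue_integral_def[OF f]
    using r by (simp add: enn2real_mult algebra_simps)
qed

lemma integral_restr:
  fixes f :: "'a \<Rightarrow> real"
  assumes "f \<in> borel_measurable M" "B \<in> sets M"
  shows "integral\<^sup>L (restr M B) f = (\<integral>x. indicator B x * f x \<partial>M)"
proof -
  have "restr M B = density M (\<lambda>x. ennreal (indicator B x))"
    by (simp add: ennreal_indicator)
  then show ?thesis
    using assms by (simp add: integral_density)
qed

context closed_pair
begin

section \<open>The vector lattice of compactly supported Lipschitz functions\<close>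

definition LC :: "('a \<Rightarrow> real) set" where
  "LC = carrier (Lip_c A)"

lemma LC_iff: "f \<in> LC \<longleftrightarrow>
    (\<exists>L. L-lipschitz_on UNIV f) \<and> (\<forall>x\<in>A. f x = 0) \<and> compact (closure {x. f x \<noteq> 0})"
  by (simp add: LC_def Lip_c_def)

lemma LC_cont: "f \<in> LC \<Longrightarrow> continuous_on UNIV f"
  by (auto simp: LC_iff intro: lipschitz_on_continuous_on)

lemma LC_measurable: "f \<in> LC \<Longrightarrow> f \<in> borel_measurable borel"
  by (intro borel_measurable_continuous_onI LC_cont)

lemma LC_zero: "f \<in> LC \<Longrightarrow> x \<in> A \<Longrightarrow> f x = 0"
  by (simp add: LC_iff)

text \<open>The support of \<open>h\<close> is a closed subset of a union of two compact sets, and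
  \<open>h\<close> vanishes on \<open>A\<close> along with \<open>f\<close> and \<open>g\<close>.
  Each lattice or vector operation then only has to supply a Lipschitz constant.\<close>

lemma LC_comb:
  assumes "f \<in> LC" "g \<in> LC" "L-lipschitz_on UNIV h" "\<And>x. f x = 0 \<Longrightarrow> g x = 0 \<Longrightarrow> h x = 0"
  shows "h \<in> LC"
proof -
  have "closure {x. h x \<noteq> 0} \<subseteq> closure {x. f x \<noteq> 0} \<union> closure {x. g x \<noteq> 0}"
    unfolding closure_Un[symmetric] using assms(4) by (intro closure_mono) blast
  then have "compact (closure {x. h x \<noteq> 0})"
    using assms(1,2) compact_Int_closed[OF compact_Un closed_closure]
    by (metis LC_iff inf.absorb2)
  then show ?thesis
    using assms unfolding LC_iff by blast
qed

lemma LC_add: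
  assumes f: "f \<in> LC" and g: "g \<in> LC"
  shows "(\<lambda>x. f x + g x) \<in> LC"
proof -
  obtain L K where "L-lipschitz_on UNIV f" "K-lipschitz_on UNIV g"
    using f g by (auto simp: LC_iff)
  from LC_comb[OF f g lipschitz_on_add[OF this]] show ?thesis
    by simp
qed

lemma LC_cmult:
  assumes f: "f \<in> LC"
  shows "(\<lambda>x. c * f x) \<in> LC"
proof -
  obtain L where "L-lipschitz_on UNIV f"
    using f by (auto simp: LC_iff)
  from LC_comb[OF f f lipschitz_on_cmult_real[OF this]] show ?thesis
    by simp
qed

lemma LC_max:
  assumes f: "f \<in> LC" and g: "g \<in> LC"
  shows "(\<lambda>x. max (f x) (g x)) \<in> LC"
proof -
  obtain L K where L: "L-lipschitz_on UNIV f" and K: "K-lipschitz_on UNIV g"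
    using f g by (auto simp: LC_iff)
  have "(max L K)-lipschitz_on UNIV (\<lambda>x. max (f x) (g x))"
  proof (rule lipschitz_onI)
    fix x y
    have "dist (f x) (f y) \<le> L * dist x y" "dist (g x) (g y) \<le> K * dist x y"
      using L K by (auto intro: lipschitz_onD)
    moreover have "L * dist x y \<le> max L K * dist x y" "K * dist x y \<le> max L K * dist x y"
      by (auto intro: mult_right_mono)
    ultimately show "dist (max (f x) (g x)) (max (f y) (g y)) \<le> max L K * dist x y"
      unfolding dist_real_def by linarith
  qed (use lipschitz_on_nonneg[OF L] in auto)
  from LC_comb[OF f g this] show ?thesis
    by simp
qed

lemma LC_uminus: "f \<in> LC \<Longrightarrow> (\<lambda>x. - f x) \<in> LC"
  using LC_cmult[of f "-1"] by simp

lemma LC_min: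
  assumes f: "f \<in> LC" and g: "g \<in> LC"
  shows "(\<lambda>x. min (f x) (g x)) \<in> LC"
proof -
  have "(\<lambda>x. min (f x) (g x)) = (\<lambda>x. - max (- f x) (- g x))"
    by auto
  then show ?thesis
    using LC_uminus[OF LC_max[OF LC_uminus[OF f] LC_uminus[OF g]]] by simp
qed

lemma LC_0: "(\<lambda>x. 0) \<in> LC"
  by (auto simp: LC_iff intro: lipschitz_on_constant)

text \<open>Comparing \<open>f x\<close> with the value 0 at points of \<open>A\<close> and taking
  the infimum over them bounds \<open>f\<close> by a multiple of the distance to \<open>A\<close>.
  This is the function that local 1-finiteness controls.\<close>

lemma LC_bound:
  assumes f: "f \<in> LC"
  obtains C K where "0 \<le> C" "compact K" "\<And>x. \<bar>f x\<bar> \<le> C * infdist x A * indicator K x"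
proof -
  obtain L where L: "L-lipschitz_on UNIV f"
    using f by (auto simp: LC_iff)
  have L0: "0 \<le> L"
    using lipschitz_on_nonneg[OF L] .
  \<comment> \<open>\<open>L + 1\<close> instead of \<open>L\<close> permits division even if the
    Lipschitz constant is 0.\<close>
  have bd: "\<bar>f x\<bar> \<le> (L + 1) * infdist x A" for x
  proof -
    have "\<bar>f x\<bar> / (L + 1) \<le> dist x a" if "a \<in> A" for a
    proof -
      have "\<bar>f x\<bar> \<le> L * dist x a"
        using lipschitz_onD[OF L, of x a] LC_zero[OF f that] by (simp add: dist_real_def)
      also have "\<dots> \<le> (L + 1) * dist x a"
        by (intro mult_right_mono) auto
      finally show ?thesis
        using L0 by (simp add: divide_le_eq mult.commute)
    qed
    then have "\<bar>f x\<bar> / (L + 1) \<le> infdist x A"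
      using A_nonempty by (auto simp: infdist_notempty intro: cINF_greatest)
    then show ?thesis
      using L0 by (simp add: divide_le_eq mult.commute)
  qed
  have out: "f x = 0" if "x \<notin> closure {x. f x \<noteq> 0}" for x
    using that closure_subset[of "{x. f x \<noteq> 0}"] by auto
  have "\<bar>f x\<bar> \<le> (L + 1) * infdist x A * indicator (closure {x. f x \<noteq> 0}) x" for x
    using bd[of x] out[of x] by (cases "x \<in> closure {x. f x \<noteq> 0}") simp_all
  moreover have "0 \<le> L + 1" "compact (closure {x. f x \<noteq> 0})"
    using f L0 by (auto simp: LC_iff)
  ultimately show ?thesis
    using that by blast
qed

section \<open>The pairing of functions with formal differences\<close>

lemma LC_integrable:
  assumes f: "f \<in> LC" and M: "radon M"
  shows "integrable M f"
proof (rule integrableI_bounded)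
  have [measurable_cong]: "sets M = sets borel"
    using M by (rule radon_sets)
  show "f \<in> borel_measurable M"
    using LC_measurable[OF f] by measurable
  obtain C K where C: "0 \<le> C" "compact K" "\<And>x. \<bar>f x\<bar> \<le> C * infdist x A * indicator K x"
    by (rule LC_bound[OF f]) blast
  have [measurable]: "K \<in> sets borel"
    using C by (simp add: compact_imp_closed)
  have "(\<integral>\<^sup>+x. ennreal (norm (f x)) \<partial>M) \<le> (\<integral>\<^sup>+x. ennreal C * (ennreal (infdist x A) * indicator K x) \<partial>M)"
  proof (rule nn_integral_mono)
    fix x
    show "ennreal (norm (f x)) \<le> ennreal C * (ennreal (infdist x A) * indicator K x)"
      using C(1) ennreal_leI[OF C(3)[of x]] by (cases "x \<in> K") (simp_all add: ennreal_mult infdist_nonneg)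
  qed
  also have "\<dots> = ennreal C * (\<integral>\<^sup>+x\<in>K. ennreal (infdist x A) \<partial>M)"
    by (rule nn_integral_cmult) measurable
  also have "\<dots> < \<infinity>"
    using nn_integral_infdist_compact[OF radon_sets[OF M] _ C(2)] M
    by (auto simp: radon_def ennreal_mult_less_top)
  finally show "(\<integral>\<^sup>+x. ennreal (norm (f x)) \<partial>M) < \<infinity>" .
qed

text \<open>Since \<open>f\<close> vanishes on \<open>A\<close>, the integral only sees the
  restriction to \<open>- A\<close>, and the two restrictions are equal as measures.\<close>

lemma integral_agree:
  assumes f: "f \<in> LC" and M: "sets M = sets borel" and N: "sets N = sets borel" and ag: "agree M N"
  shows "integral\<^sup>L M f = integral\<^sup>L N f"
proof -
  have *: "integral\<^sup>L L f = integral\<^sup>L (restr L (- A)) f" if "sets L = sets borel" for L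
  proof -
    have [measurable_cong]: "sets L = sets borel"
      by fact
    have "f \<in> borel_measurable L"
      using LC_measurable[OF f] by measurable
    then have "integral\<^sup>L (restr L (- A)) f = (\<integral>x. indicator (- A) x * f x \<partial>L)"
      by (rule integral_restr) (simp add: that)
    also have "\<dots> = integral\<^sup>L L f"
      using LC_zero[OF f] by (intro Bochner_Integration.integral_cong) (auto simp: indicator_def)
    finally show ?thesis ..
  qed
  have "restr M (- A) = restr N (- A)"
    using M N ag by (intro measure_eqI) (auto simp: emeasure_restr agree_def)
  then show ?thesis
    using *[OF M] *[OF N] by simp
qed

lemma rel_integral_cls:
  assumes f: "f \<in> LC" and M: "sets M = sets borel"
  shows "rel_integral (cls M) f = integral\<^sup>L M f"
proof -
  have "integral\<^sup>L L f = integral\<^sup>L M f" if "L \<in> cls M" for L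
    using integral_agree[OF f, of M L] that unfolding mem_cls_iff by simp
  then have "(\<lambda>L. integral\<^sup>L L f) ` cls M = (\<lambda>_. integral\<^sup>L M f) ` cls M"
    by (rule image_cong[OF refl])
  also have "\<dots> = {integral\<^sup>L M f}"
    by (rule image_constant[OF self_mem_cls[OF M]])
  finally show ?thesis
    by (simp add: rel_integral_def)
qed

lemma integral_add_radon:
  assumes "f \<in> LC" "radon M" "radon N"
  shows "integral\<^sup>L (measure_add M N) f = integral\<^sup>L M f + integral\<^sup>L N f"
  using assms by (intro integrable_measure_add(2) LC_integrable) (simp_all add: radon_sets)

text \<open>If \<open>(M, N)\<close> and \<open>(P, Q)\<close> represent the same element, then
  \<open>M + Q\<close> and \<open>P + N\<close> agree off \<open>A\<close>. Hence all
  representatives give one number and \<open>the_elem\<close> meets a singleton.\<close>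

lemma hat_el:
  assumes f: "f \<in> LC" and M: "radon M" and N: "radon N"
  shows "hat A f (el M N) = integral\<^sup>L M f - integral\<^sup>L N f"
proof -
  have "(\<lambda>(m, n). rel_integral m f - rel_integral n f) ` el M N = {integral\<^sup>L M f - integral\<^sup>L N f}"
  proof -
    have "(case p of (m, n) \<Rightarrow> rel_integral m f - rel_integral n f) = integral\<^sup>L M f - integral\<^sup>L N f"
      if p: "p \<in> el M N" for p
    proof -
      obtain P Q where *: "radon P" "radon Q" "p = (cls P, cls Q)" "\<forall>E. small E \<longrightarrow> dif M N E = dif P Q E"
        using p unfolding mem_el_iff[OF M N] by blast
      have "measure M E + measure Q E = measure P E + measure N E" if "small E" for E
        using *(4) that by (auto simp: dif_def algebra_simps)
      then have "agree (measure_add M Q) (measure_add P N)"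
        using * M N by (simp add: agree_radon_iff radon_add measure_add_small)
      then have "integral\<^sup>L (measure_add M Q) f = integral\<^sup>L (measure_add P N) f"
        using * M N by (intro integral_agree[OF f]) (simp_all add: radon_sets)
      then show ?thesis
        using * M N f by (simp add: integral_add_radon rel_integral_cls radon_sets)
    qed
    then have "(\<lambda>(m, n). rel_integral m f - rel_integral n f) ` el M N
      = (\<lambda>_. integral\<^sup>L M f - integral\<^sup>L N f) ` el M N"
      by (rule image_cong[OF refl])
    also have "\<dots> = {integral\<^sup>L M f - integral\<^sup>L N f}"
      by (rule image_constant[OF self_mem_el[OF M N]])
    finally show ?thesis .
  qed
  then show ?thesis
    using el_carrier[OF M N] by (simp add: hat_def)
qed

lemma integral_restr_radon:
  assumes "f \<in> LC" "radon M" "B \<in> sets borel"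
  shows "integral\<^sup>L (restr M B) f = (\<integral>x. indicator B x * f x \<partial>M)"
  using assms LC_integrable[OF assms(1,2)] by (intro integral_restr) (auto simp: radon_sets)

section \<open>Linearity and monotonicity of the functionals\<close>

lemma hat_linear:
  assumes f: "f \<in> LC"
  shows "linear_functional (M1_space A) (hat A f)"
  unfolding linear_functional_def
proof (intro conjI allI ballI)
  fix X Y assume "X \<in> carrier (M1_space A)" "Y \<in> carrier (M1_space A)"
  then obtain M N P Q where "radon M" "radon N" "radon P" "radon Q" "X = el M N" "Y = el P Q"
    unfolding carrier_M1_space by blast
  then show "hat A f (vadd (M1_space A) X Y) = hat A f X + hat A f Y"
    by (simp add: f vadd_el hat_el radon_add integral_add_radon)
next
  fix c X assume "X \<in> carrier (M1_space A)"
  then obtain M N where "radon M" "radon N" "X = el M N"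
    unfolding carrier_M1_space by blast
  then show "hat A f (vscale (M1_space A) c X) = c * hat A f X"
    by (simp add: f vscale_el hat_el radon_scale integral_scale_measure LC_integrable algebra_simps)
qed

lemma integral_eq_add:
  assumes f: "f \<in> LC" and "radon M" "radon N" "radon R"
    and "\<And>E. small E \<Longrightarrow> measure M E = measure N E + measure R E"
  shows "integral\<^sup>L M f = integral\<^sup>L N f + integral\<^sup>L R f"
proof -
  have "agree M (measure_add N R)"
    using assms by (simp add: agree_radon_iff radon_add measure_add_small)
  then have "integral\<^sup>L M f = integral\<^sup>L (measure_add N R) f"
    using assms by (intro integral_agree) (simp_all add: radon_sets)
  then show ?thesis
    using assms by (simp add: integral_add_radon)
qed

text \<open>By the description of the order, \<open>M\<close> is on small sets the sum of
  \<open>N\<close> and a Radon measure, whose integral of \<open>f\<close> is nonnegative.\<close>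

lemma integral_mono_small:
  assumes f: "f \<in> LC" "\<And>x. 0 \<le> f x" and M: "radon M" and N: "radon N"
    and le: "\<And>E. small E \<Longrightarrow> measure N E \<le> measure M E"
  shows "integral\<^sup>L N f \<le> integral\<^sup>L M f"
proof -
  have "el N (null_measure borel) \<sqsubseteq>\<^bsub>M1_space A\<^esub> el M (null_measure borel)"
    using le by (simp add: le_el_iff M N radon_null dif_null_right)
  then obtain R where R: "radon R" "\<And>E. small E \<Longrightarrow> measure M E = measure N E + measure R E"
    by (auto simp: le_el_iff_ex M N radon_null dif_null_right)
  have "integral\<^sup>L M f = integral\<^sup>L N f + integral\<^sup>L R f"
    by (rule integral_eq_add[OF f(1) M N R])
  moreover have "0 \<le> integral\<^sup>L R f"
    using f(2) by simp
  ultimately show ?thesis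
    by simp
qed

lemma hat_mono:
  assumes f: "f \<in> LC" "\<And>x. 0 \<le> f x"
    and X: "X \<in> carrier (M1_space A)" and Y: "Y \<in> carrier (M1_space A)" and "X \<sqsubseteq>\<^bsub>M1_space A\<^esub> Y"
  shows "hat A f X \<le> hat A f Y"
proof -
  obtain M N P Q where *: "radon M" "radon N" "radon P" "radon Q" and XY: "X = el M N" "Y = el P Q"
    using X Y unfolding carrier_M1_space by blast
  have "measure (measure_add M Q) E \<le> measure (measure_add P N) E" if "small E" for E
    using assms(5) that unfolding XY le_el_iff[OF *] by (simp add: * measure_add_small dif_def algebra_simps)
  then have "integral\<^sup>L (measure_add M Q) f \<le> integral\<^sup>L (measure_add P N) f"
    by (intro integral_mono_small f radon_add *)
  then show ?thesis
    by (simp add: XY hat_el integral_add_radon f *)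
qed

lemma hat_add:
  assumes "f \<in> LC" "g \<in> LC" "X \<in> carrier (M1_space A)"
  shows "hat A (\<lambda>x. f x + g x) X = hat A f X + hat A g X"
proof -
  obtain M N where "radon M" "radon N" "X = el M N"
    using assms(3) unfolding carrier_M1_space by blast
  then show ?thesis
    using assms by (simp add: hat_el LC_add LC_integrable)
qed

lemma hat_cmult:
  assumes "f \<in> LC" "X \<in> carrier (M1_space A)"
  shows "hat A (\<lambda>x. c * f x) X = c * hat A f X"
proof -
  obtain M N where "radon M" "radon N" "X = el M N"
    using assms(2) unfolding carrier_M1_space by blast
  then show ?thesis
    using assms by (simp add: hat_el LC_cmult algebra_simps)
qed

end

section \<open>Order boundedness and order continuity\<close>

lemma least_imp_upper_bound: "is_lub E l {x, y} \<Longrightarrow> x \<in> carrier E \<Longrightarrow> y \<in> carrier E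
    \<Longrightarrow> l \<in> carrier E \<and> x \<sqsubseteq>\<^bsub>E\<^esub> l \<and> y \<sqsubseteq>\<^bsub>E\<^esub> l"
  by (auto simp: least_def Upper_def)

text \<open>\<open>join\<close> is a choice term: nothing is known about it until some least upper
  bound has been exhibited.\<close>

lemma is_lub_join:
  assumes "is_lub E l {x, y}"
  shows "is_lub E (x \<squnion>\<^bsub>E\<^esub> y) {x, y}"
  unfolding Lattice.join_def Lattice.sup_def by (rule someI[where P = "\<lambda>l. is_lub E l {x, y}", OF assms])

lemma is_glb_meet:
  assumes "is_glb E l {x, y}"
  shows "is_glb E (x \<sqinter>\<^bsub>E\<^esub> y) {x, y}"
  unfolding Lattice.meet_def Lattice.inf_def by (rule someI[where P = "\<lambda>l. is_glb E l {x, y}", OF assms])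

text \<open>The record carries no order axioms, so antisymmetry, which makes the choice unique, is a
  premise.\<close>

lemma join_eqI:
  assumes "is_lub E l {x, y}" "\<And>a b. a \<sqsubseteq>\<^bsub>E\<^esub> b \<Longrightarrow> b \<sqsubseteq>\<^bsub>E\<^esub> a \<Longrightarrow> a = b"
  shows "x \<squnion>\<^bsub>E\<^esub> y = l"
  by (rule assms(2)) (use assms(1) is_lub_join[OF assms(1)] in \<open>simp_all add: least_def\<close>)

lemma meet_eqI:
  assumes "is_glb E l {x, y}" "\<And>a b. a \<sqsubseteq>\<^bsub>E\<^esub> b \<Longrightarrow> b \<sqsubseteq>\<^bsub>E\<^esub> a \<Longrightarrow> a = b"
  shows "x \<sqinter>\<^bsub>E\<^esub> y = l"
  by (rule assms(2)) (use assms(1) is_glb_meet[OF assms(1)] in \<open>simp_all add: greatest_def\<close>)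

lemma vabs_real_vs: "vabs real_vs t = \<bar>t\<bar>"
  unfolding vabs_def
proof (rule join_eqI)
  show "is_lub real_vs \<bar>t\<bar> {t, vscale real_vs (- 1) t}"
    by (auto simp: least_def Upper_def real_vs_def abs_le_iff)
qed (simp add: real_vs_def)

context closed_pair
begin

section \<open>Absolute values in the space of formal differences\<close>

lemma measure_small_split:
  assumes L: "radon L" and E: "small E" and Y: "Y \<in> sets borel"
  shows "measure L E = measure L (E \<inter> Y) + measure L (E \<inter> - Y)"
proof -
  have sm: "small (E \<inter> Y)" "small (E \<inter> - Y)"
    using Y smallD(1)[OF E] by (auto intro!: small_subset[OF E])
  have "emeasure L (E \<inter> Y \<union> E \<inter> - Y) = emeasure L (E \<inter> Y) + emeasure L (E \<inter> - Y)"
    by (rule emeasure_small_Un[OF L sm]) blast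
  moreover have "E \<inter> Y \<union> E \<inter> - Y = E"
    by blast
  ultimately have "ennreal (measure L E) = ennreal (measure L (E \<inter> Y) + measure L (E \<inter> - Y))"
    by (simp add: emeasure_small[OF L, symmetric] E sm)
  then show ?thesis
    by (subst (asm) ennreal_inj) auto
qed

text \<open>This is the identity that writes the absolute value of \<open>M - N\<close> as twice the
  supremum of \<open>M\<close> and \<open>N\<close> minus their sum.\<close>

lemma is_lub_abs_el:
  assumes M: "radon M" and N: "radon N"
  defines "S \<equiv> sup_measure' M N"
  shows "is_lub (M1_space A) (el (measure_add S S) (measure_add M N)) {el M N, el N M}"
proof -
  have [simp]: "sets M = sets borel" "sets N = sets borel"
    using M N by (simp_all add: radon_sets)
  have S: "radon S"
    unfolding S_def by (rule radon_sup[OF M N])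
  note rad = M N S radon_add[OF S S] radon_add[OF M N]
  have MS: "measure M E \<le> measure S E" and NS: "measure N E \<le> measure S E" if E: "small E" for E
  proof -
    have "ennreal (measure M E) \<le> ennreal (measure S E)" "ennreal (measure N E) \<le> ennreal (measure S E)"
      unfolding emeasure_small[OF M E, symmetric] emeasure_small[OF N E, symmetric] emeasure_small[OF S E, symmetric]
      unfolding S_def using smallD(1)[OF E]
      by (auto intro: le_emeasure_sup_measure'1 le_emeasure_sup_measure'2)
    then show "measure M E \<le> measure S E" "measure N E \<le> measure S E"
      by simp_all
  qed
  have SE: "2 * measure S E \<le> u + measure M E + measure N E"
    if E: "small E"
      and u: "\<And>Y. Y \<in> sets borel \<Longrightarrow> 2 * (measure M (E \<inter> Y) + measure N (E \<inter> - Y)) \<le> u + measure M E + measure N E"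
    for E u
  proof -
    let ?r = "(u + measure M E + measure N E) / 2"
    have "emeasure S E \<le> ennreal ?r"
      unfolding S_def
    proof (subst emeasure_sup_measure')
      show "(SUP Y\<in>sets M. emeasure M (E \<inter> Y) + emeasure N (E \<inter> - Y)) \<le> ennreal ?r"
      proof (rule SUP_least)
        fix Y assume "Y \<in> sets M"
        then have Y: "Y \<in> sets borel"
          by simp
        have sm: "small (E \<inter> Y)" "small (E \<inter> - Y)"
          using Y smallD(1)[OF E] by (auto intro!: small_subset[OF E])
        have "emeasure M (E \<inter> Y) + emeasure N (E \<inter> - Y) = ennreal (measure M (E \<inter> Y) + measure N (E \<inter> - Y))"
          by (simp add: emeasure_small[OF M sm(1)] emeasure_small[OF N sm(2)])
        also have "\<dots> \<le> ennreal ?r"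
          using u[OF Y] by (intro ennreal_leI) simp
        finally show "emeasure M (E \<inter> Y) + emeasure N (E \<inter> - Y) \<le> ennreal ?r" .
      qed
    qed (use smallD(1)[OF E] in simp_all)
    \<comment> \<open>The cut \<open>Y = UNIV\<close> already shows that the bound is nonnegative,
      as the return from \<open>ennreal\<close> to the reals requires.\<close>
    moreover have "0 \<le> ?r"
      using order_trans[OF _ u[of UNIV]] by simp
    ultimately show ?thesis
      unfolding emeasure_small[OF S E] by (subst (asm) ennreal_le_iff) auto
  qed
  show ?thesis
    unfolding least_def
  proof (intro conjI ballI)
    show "Upper (M1_space A) {el M N, el N M} \<subseteq> carrier (M1_space A)"
      by (auto simp: Upper_def)
    have "dif M N E \<le> dif (measure_add S S) (measure_add M N) E"
      "dif N M E \<le> dif (measure_add S S) (measure_add M N) E" if "small E" for E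
      using MS[OF that] NS[OF that] by (simp_all add: dif_def measure_add_small rad that)
    then show "el (measure_add S S) (measure_add M N) \<in> Upper (M1_space A) {el M N, el N M}"
      by (auto simp: Upper_def le_el_iff rad el_carrier)
  next
    fix u assume "u \<in> Upper (M1_space A) {el M N, el N M}"
    then have u: "el M N \<sqsubseteq>\<^bsub>M1_space A\<^esub> u" "el N M \<sqsubseteq>\<^bsub>M1_space A\<^esub> u" "u \<in> carrier (M1_space A)"
      using el_carrier[OF M N] el_carrier[OF N M] by (auto simp: Upper_def)
    then obtain P Q where P: "radon P" and Q: "radon Q" and uPQ: "u = el P Q"
      unfolding carrier_M1_space by blast
    have *: "dif M N E \<le> dif P Q E" "dif N M E \<le> dif P Q E" if "small E" for E
      using u(1,2) that unfolding uPQ le_el_iff[OF M N P Q] le_el_iff[OF N M P Q] by auto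
    have "dif (measure_add S S) (measure_add M N) E \<le> dif P Q E" if E: "small E" for E
    proof -
      \<comment> \<open>On \<open>E \<inter> Y\<close> the upper bound dominates
        \<open>M - N\<close>, on the rest of \<open>E\<close> it dominates \<open>N - M\<close>;
        adding the two gives the estimate for every cut.\<close>
      have "2 * measure S E \<le> dif P Q E + measure M E + measure N E"
      proof (rule SE[OF E])
        fix Y :: "'a set" assume Y: "Y \<in> sets borel"
        have sm: "small (E \<inter> Y)" "small (E \<inter> - Y)"
          using Y smallD(1)[OF E] by (auto intro!: small_subset[OF E])
        show "2 * (measure M (E \<inter> Y) + measure N (E \<inter> - Y)) \<le> dif P Q E + measure M E + measure N E"
          using *(1)[OF sm(1)] *(2)[OF sm(2)]
          unfolding dif_def measure_small_split[OF M E Y] measure_small_split[OF N E Y] measure_small_split[OF P E Y] 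
            measure_small_split[OF Q E Y] by simp
      qed
      then show ?thesis
        by (simp add: dif_def measure_add_small rad E)
    qed
    then show "el (measure_add S S) (measure_add M N) \<sqsubseteq>\<^bsub>M1_space A\<^esub> u"
      by (simp add: uPQ le_el_iff rad P Q)
  qed
qed

lemma vabs_M1_space:
  assumes "X \<in> carrier (M1_space A)"
  shows "vabs (M1_space A) X \<in> carrier (M1_space A)" "X \<sqsubseteq>\<^bsub>M1_space A\<^esub> vabs (M1_space A) X"
    "vscale (M1_space A) (- 1) X \<sqsubseteq>\<^bsub>M1_space A\<^esub> vabs (M1_space A) X"
    "vscale (M1_space A) (- 1) X \<in> carrier (M1_space A)"
proof -
  obtain M N where MN: "radon M" "radon N" and X: "X = el M N"
    using assms unfolding carrier_M1_space by blast
  have neg: "vscale (M1_space A) (- 1) X = el N M"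
    by (simp add: X vscale_el MN)
  have "is_lub (M1_space A) (vabs (M1_space A) X) {X, vscale (M1_space A) (- 1) X}"
    using is_lub_join[OF is_lub_abs_el[OF MN]] unfolding vabs_def neg unfolding X .
  from least_imp_upper_bound[OF this]
  show "vabs (M1_space A) X \<in> carrier (M1_space A)" "X \<sqsubseteq>\<^bsub>M1_space A\<^esub> vabs (M1_space A) X"
    "vscale (M1_space A) (- 1) X \<sqsubseteq>\<^bsub>M1_space A\<^esub> vabs (M1_space A) X"
    "vscale (M1_space A) (- 1) X \<in> carrier (M1_space A)"
    using assms MN by (auto simp: neg el_carrier)
qed

lemma LC_pos: "f \<in> LC \<Longrightarrow> (\<lambda>x. max (f x) 0) \<in> LC"
  using LC_max[OF _ LC_0] by simp

lemma LC_abs: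
  assumes "f \<in> LC"
  shows "(\<lambda>x. \<bar>f x\<bar>) \<in> LC"
proof -
  have "(\<lambda>x. max (f x) (- f x)) = (\<lambda>x. \<bar>f x\<bar>)"
    by auto
  then show ?thesis
    using LC_max[OF assms LC_uminus[OF assms]] by simp
qed

lemma hat_pos_neg:
  assumes f: "f \<in> LC" and X: "X \<in> carrier (M1_space A)"
  shows "hat A f X = hat A (\<lambda>x. max (f x) 0) X - hat A (\<lambda>x. max (- f x) 0) X"
    and "hat A (\<lambda>x. \<bar>f x\<bar>) X = hat A (\<lambda>x. max (f x) 0) X + hat A (\<lambda>x. max (- f x) 0) X"
proof -
  note p = LC_pos[OF f] and n = LC_pos[OF LC_uminus[OF f]]
  have "f = (\<lambda>x. max (f x) 0 + - 1 * max (- f x) 0)"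
    by auto
  then have "hat A f X = hat A (\<lambda>x. max (f x) 0 + - 1 * max (- f x) 0) X"
    by simp
  also have "\<dots> = hat A (\<lambda>x. max (f x) 0) X + - 1 * hat A (\<lambda>x. max (- f x) 0) X"
    unfolding hat_add[OF p LC_cmult[OF n] X] hat_cmult[OF n X] ..
  finally show "hat A f X = hat A (\<lambda>x. max (f x) 0) X - hat A (\<lambda>x. max (- f x) 0) X"
    by simp
  have "(\<lambda>x. \<bar>f x\<bar>) = (\<lambda>x. max (f x) 0 + max (- f x) 0)"
    by auto
  then show "hat A (\<lambda>x. \<bar>f x\<bar>) X = hat A (\<lambda>x. max (f x) 0) X + hat A (\<lambda>x. max (- f x) 0) X"
    by (simp add: hat_add[OF p n X])
qed

text \<open>The positive and negative parts of \<open>f\<close> give monotone functionals, so their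
  values at the ends of an interval bound the difference in between.\<close>

lemma hat_order_bounded:
  assumes f: "f \<in> LC"
  shows "order_bounded (M1_space A) (hat A f)"
  unfolding order_bounded_def
proof (intro ballI)
  fix a b assume a: "a \<in> carrier (M1_space A)" and b: "b \<in> carrier (M1_space A)"
  let ?p = "\<lambda>x. max (f x) 0" and ?n = "\<lambda>x. max (- f x) 0"
  note p = LC_pos[OF f] and n = LC_pos[OF LC_uminus[OF f]]
  have "hat A f X \<in> {hat A ?p a - hat A ?n b..hat A ?p b - hat A ?n a}" if "X \<in> \<lbrace>a..b\<rbrace>\<^bsub>M1_space A\<^esub>" for X
  proof -
    have X: "X \<in> carrier (M1_space A)" "a \<sqsubseteq>\<^bsub>M1_space A\<^esub> X" "X \<sqsubseteq>\<^bsub>M1_space A\<^esub> b"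
      using that by (auto simp: at_least_at_most_def)
    have "hat A ?p a \<le> hat A ?p X" "hat A ?p X \<le> hat A ?p b" "hat A ?n a \<le> hat A ?n X" "hat A ?n X \<le> hat A ?n b"
      using X a b p n by (auto intro!: hat_mono)
    then show ?thesis
      unfolding hat_pos_neg(1)[OF f X(1)] by simp
  qed
  then have "hat A f ` \<lbrace>a..b\<rbrace>\<^bsub>M1_space A\<^esub> \<subseteq> {hat A ?p a - hat A ?n b..hat A ?p b - hat A ?n a}"
    by blast
  then show "bounded (hat A f ` \<lbrace>a..b\<rbrace>\<^bsub>M1_space A\<^esub>)"
    using bounded_closed_interval bounded_subset by blast
qed

text \<open>A monotone linear functional satisfies the estimate with the absolute value of
  \<open>X\<close>, as both \<open>X\<close> and its negative lie below it. Adding this for both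
  parts of \<open>f\<close> produces the absolute value of \<open>f\<close>.\<close>

lemma abs_hat_le:
  assumes f: "f \<in> LC" and X: "X \<in> carrier (M1_space A)" and Y: "Y \<in> carrier (M1_space A)"
    and le: "vabs (M1_space A) X \<sqsubseteq>\<^bsub>M1_space A\<^esub> Y"
  shows "\<bar>hat A f X\<bar> \<le> hat A (\<lambda>x. \<bar>f x\<bar>) Y"
proof -
  let ?V = "vabs (M1_space A) X" and ?p = "\<lambda>x. max (f x) 0" and ?n = "\<lambda>x. max (- f x) 0"
  note p = LC_pos[OF f] and n = LC_pos[OF LC_uminus[OF f]] and V = vabs_M1_space[OF X]
  have neg: "hat A g (vscale (M1_space A) (- 1) X) = - hat A g X" if "g \<in> LC" for g
    using hat_linear[OF that] X unfolding linear_functional_def by simp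
  have *: "\<bar>hat A g X\<bar> \<le> hat A g ?V" if g: "g \<in> LC" "\<And>x. 0 \<le> g x" for g
  proof -
    have "hat A g X \<le> hat A g ?V" "- hat A g X \<le> hat A g ?V"
      unfolding neg[OF g(1), symmetric] by (intro hat_mono g V X)+
    then show ?thesis
      by simp
  qed
  have "\<bar>hat A f X\<bar> \<le> hat A ?p ?V + hat A ?n ?V"
    unfolding hat_pos_neg(1)[OF f X] using *[OF p] *[OF n] by simp
  also have "\<dots> = hat A (\<lambda>x. \<bar>f x\<bar>) ?V"
    by (rule hat_pos_neg(2)[OF f V(1), symmetric])
  also have "\<dots> \<le> hat A (\<lambda>x. \<bar>f x\<bar>) Y"
    by (intro hat_mono LC_abs f V Y le) simp
  finally show ?thesis .
qed

section \<open>Integrals along decreasing nets\<close>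

lemma LC_bounded:
  assumes f: "f \<in> LC"
  obtains B where "0 \<le> B" "\<And>x. \<bar>f x\<bar> \<le> B"
proof -
  let ?K = "closure {x. f x \<noteq> 0}"
  have "compact (f ` ?K)"
    using f LC_cont[OF f] by (intro compact_continuous_image) (auto simp: LC_iff intro: continuous_on_subset)
  then obtain B where B: "\<And>y. y \<in> f ` ?K \<Longrightarrow> norm y \<le> B"
    using compact_imp_bounded bounded_iff by metis
  have "\<bar>f x\<bar> \<le> max B 0" for x
  proof (cases "f x = 0")
    case False
    then have "x \<in> ?K"
      using closure_subset[of "{x. f x \<noteq> 0}"] by auto
    then show ?thesis
      using B[of "f x"] by auto
  qed simp
  then show ?thesis
    using that[of "max B 0"] by auto
qed

text \<open>The support of \<open>f\<close> may meet \<open>A\<close>; the positive level keeps this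
  closed subset of it away from \<open>A\<close>.\<close>

lemma LC_superlevel_small:
  assumes f: "f \<in> LC" and "0 < d"
  shows "small {x. d \<le> f x}"
proof -
  have cl: "closed {x. d \<le> f x}"
    by (intro closed_Collect_le continuous_on_const LC_cont f)
  have sub: "{x. d \<le> f x} \<subseteq> closure {x. f x \<noteq> 0}"
    using \<open>0 < d\<close> closure_subset[of "{x. f x \<noteq> 0}"] by auto
  have "compact (closure {x. f x \<noteq> 0} \<inter> {x. d \<le> f x})"
    using f cl by (intro compact_Int_closed) (auto simp: LC_iff)
  then have "compact {x. d \<le> f x}"
    using sub by (simp add: inf_absorb2)
  moreover have "{x. d \<le> f x} \<subseteq> - A"
    using LC_zero[OF f] \<open>0 < d\<close> by auto
  ultimately show ?thesis
    by (rule small_compact)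
qed

lemma integral_split:
  assumes f: "f \<in> LC" and M: "radon M" and B: "B \<in> sets borel"
  shows "integral\<^sup>L M f = integral\<^sup>L (restr M B) f + integral\<^sup>L (restr M (- B)) f"
proof -
  have int: "integrable M (\<lambda>x. indicator C x * f x)" if "C \<in> sets borel" for C
    using LC_integrable[OF f M] that integrable_mult_indicator[of C M f] by (simp add: radon_sets[OF M])
  have "integral\<^sup>L M f = (\<integral>x. indicator B x * f x + indicator (- B) x * f x \<partial>M)"
    by (intro Bochner_Integration.integral_cong) (auto simp: indicator_def)
  also have "\<dots> = (\<integral>x. indicator B x * f x \<partial>M) + (\<integral>x. indicator (- B) x * f x \<partial>M)"
    using B by (intro Bochner_Integration.integral_add int) auto
  finally show ?thesis
    using f M B by (simp add: integral_restr_radon)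
qed

lemma measure_restr_small:
  assumes "radon M" "B \<in> sets borel" "small E"
  shows "measure (restr M B) E = measure M (E \<inter> B)"
  using assms smallD(1)[OF assms(3)] by (simp add: measure_def emeasure_restr radon_sets)

text \<open>Almost all of the integral of \<open>f\<close> is carried by a compact set \<open>{x. d \<le> f x}\<close> disjoint from \<open>A\<close>.\<close>

lemma LC_integral_tail:
  assumes f: "f \<in> LC" "\<And>x. 0 \<le> f x" and M: "radon M" and e: "0 < e"
  obtains E where "small E" "integral\<^sup>L (restr M (- E)) f < e"
proof -
  \<comment> \<open>Every threshold is positive, so each set is small; the thresholds tend to 0, so
    the sets exhaust the set where \<open>f\<close> is positive.\<close>
  define E where "E n = {x. 1 / real (Suc n) \<le> f x}" for n
  have sm: "small (E n)" for n
    unfolding E_def by (intro LC_superlevel_small f) simp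
  note EB = smallD(1)[OF sm]
  have [measurable_cong]: "sets M = sets borel"
    using M by (rule radon_sets)
  note [measurable] = LC_measurable[OF f(1)] EB
  have "(\<lambda>n. \<integral>x. indicator (- E n) x * f x \<partial>M) \<longlonglongrightarrow> (\<integral>x. 0 \<partial>M)"
  proof (rule integral_dominated_convergence[where w = f])
    show "integrable M f"
      by (rule LC_integrable[OF f(1) M])
    show "AE x in M. (\<lambda>n. indicator (- E n) x * f x) \<longlonglongrightarrow> 0"
    proof (rule AE_I2)
      fix x
      show "(\<lambda>n. indicator (- E n) x * f x) \<longlonglongrightarrow> 0"
      proof (cases "f x = 0")
        case False
        then have "0 < f x"
          using f(2)[of x] by simp
        then obtain N where N: "inverse (real (Suc N)) < f x"
          using reals_Archimedean by blast
        have "indicator (- E n) x * f x = 0" if "N \<le> n" for n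
        proof -
          have "1 / real (Suc n) \<le> inverse (real (Suc N))"
            using that by (simp add: field_simps)
          then show ?thesis
            using N by (simp add: E_def)
        qed
        then show ?thesis
          by (intro tendsto_eventually) (auto simp: eventually_sequentially)
      qed simp
    qed
    show "AE x in M. norm (indicator (- E n) x * f x) \<le> f x" for n
      using f(2) by (auto simp: indicator_def)
  qed measurable
  then have "\<forall>\<^sub>F n in sequentially. (\<integral>x. indicator (- E n) x * f x \<partial>M) < e"
    using e by (intro order_tendstoD(2)[where y = "\<integral>x. 0 \<partial>M"]) simp_all
  then obtain n where "(\<integral>x. indicator (- E n) x * f x \<partial>M) < e"
    by (auto simp: eventually_sequentially)
  moreover have "integral\<^sup>L (restr M (- E n)) f = (\<integral>x. indicator (- E n) x * f x \<partial>M)"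
    using EB by (intro integral_restr_radon f M) auto
  ultimately show ?thesis
    using that[OF sm[of n]] by simp
qed

lemma integral_restr_small_le:
  assumes f: "f \<in> LC" "\<And>x. f x \<le> B" and M: "radon M" and E: "small E"
  shows "integral\<^sup>L (restr M E) f \<le> B * measure M E"
proof -
  note EB = smallD(1)[OF E]
  have "integral\<^sup>L (restr M E) f = (\<integral>x. indicator E x * f x \<partial>M)"
    by (rule integral_restr_radon[OF f(1) M EB])
  also have "\<dots> \<le> (\<integral>x. B * indicator E x \<partial>M)"
  proof (rule integral_mono)
    show "integrable M (\<lambda>x. indicator E x * f x)"
      using integrable_mult_indicator[of E M f] EB LC_integrable[OF f(1) M] by (simp add: radon_sets[OF M])
    show "integrable M (\<lambda>x. B * indicator E x)"
      using small_finite[OF M E] EB by (auto simp: radon_sets[OF M])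
    show "indicator E x * f x \<le> B * indicator E x" for x
      using f(2)[of x] by (auto simp: indicator_def)
  qed
  also have "\<dots> = B * measure M E"
    by (simp add: radon_space[OF M])
  finally show ?thesis .
qed

text \<open>The index \<open>i\<close> fixes a small \<open>E\<close> with tail below
  \<open>e / 2\<close>, and the tail stays below it at later indices. The index \<open>j\<close>
  makes the mass of \<open>E\<close> small, and a common successor \<open>k\<close> of both has the
  two properties at once.\<close>

lemma integral_decreasing_net_null:
  assumes I: "directed_index I r" and \<nu>: "\<And>i. i \<in> I \<Longrightarrow> radon (\<nu> i)"
    and dec: "\<And>i j E. i \<in> I \<Longrightarrow> j \<in> I \<Longrightarrow> r i j \<Longrightarrow> small E \<Longrightarrow> measure (\<nu> j) E \<le> measure (\<nu> i) E"
    and null: "\<And>E. small E \<Longrightarrow> (INF i\<in>I. emeasure (\<nu> i) E) = 0"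
    and f: "f \<in> LC" "\<And>x. 0 \<le> f x" and e: "0 < e"
  shows "\<exists>i\<in>I. integral\<^sup>L (\<nu> i) f < e"
proof -
  obtain i where i: "i \<in> I"
    using I by (auto simp: directed_index_def)
  obtain E where E: "small E" and tail: "integral\<^sup>L (restr (\<nu> i) (- E)) f < e / 2"
    using LC_integral_tail[OF f \<nu>[OF i], of "e / 2"] e by auto
  obtain B where B: "0 \<le> B" "\<And>x. \<bar>f x\<bar> \<le> B"
    by (rule LC_bounded[OF f(1)]) blast
  have B': "f x \<le> B" for x
    using B(2)[of x] by simp
  \<comment> \<open>\<open>B + 1\<close> avoids division by 0 and leaves \<open>B * d\<close>
    strictly below \<open>e / 2\<close>.\<close>
  define d where "d = e / (2 * (B + 1))"
  have d: "0 < d" "B * d < e / 2"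
    using e B(1) by (auto simp: d_def field_simps)
  have "(INF i\<in>I. emeasure (\<nu> i) E) < ennreal d"
    using null[OF E] d(1) by simp
  then obtain j where j: "j \<in> I" "emeasure (\<nu> j) E < ennreal d"
    by (auto simp: INF_less_iff)
  then have jd: "measure (\<nu> j) E < d"
    using emeasure_small[OF \<nu>[OF j(1)] E] d(1) by (simp add: ennreal_less_iff)
  obtain k where k: "k \<in> I" "r i k" "r j k"
    using I i j(1) by (auto simp: directed_index_def)
  have EB: "E \<in> sets borel" "- E \<in> sets borel"
    using smallD(1)[OF E] by auto
  have "integral\<^sup>L (restr (\<nu> k) E) f \<le> B * measure (\<nu> k) E"
    by (rule integral_restr_small_le[OF f(1) B' \<nu>[OF k(1)] E])
  also have "\<dots> \<le> B * d"
    using dec[OF j(1) k(1,3) E] jd B(1) by (intro mult_left_mono) auto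
  also have "\<dots> < e / 2"
    by (rule d)
  finally have 1: "integral\<^sup>L (restr (\<nu> k) E) f < e / 2" .
  have "integral\<^sup>L (restr (\<nu> k) (- E)) f \<le> integral\<^sup>L (restr (\<nu> i) (- E)) f"
  proof (rule integral_mono_small[OF f radon_restr[OF \<nu>[OF i] EB(2)] radon_restr[OF \<nu>[OF k(1)] EB(2)]])
    fix F assume F: "small F"
    have "small (F \<inter> - E)"
      using smallD(1)[OF F] EB by (intro small_subset[OF F]) auto
    from dec[OF i k(1,2) this]
    show "measure (restr (\<nu> k) (- E)) F \<le> measure (restr (\<nu> i) (- E)) F"
      using F EB \<nu> i k(1) by (simp add: measure_restr_small)
  qed
  with 1 tail have "integral\<^sup>L (\<nu> k) f < e"
    unfolding integral_split[OF f(1) \<nu>[OF k(1)] EB(1)] by simp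
  with k(1) show ?thesis
    by blast
qed

text \<open>The order is defined by adding elements of the cone, so the witness for \<open>X\<close>
  being above zero is the representing measure.\<close>

lemma pos_el:
  assumes "X \<in> carrier (M1_space A)" "vzero (M1_space A) \<sqsubseteq>\<^bsub>M1_space A\<^esub> X"
  obtains R where "radon R" "X = el R (null_measure borel)"
proof -
  obtain M N where MN: "radon M" "radon N" and X: "X = el M N"
    using assms(1) unfolding carrier_M1_space by blast
  obtain R where R: "radon R" "\<forall>E. small E \<longrightarrow> dif M N E = measure R E"
    using assms(2) unfolding X vzero_M1_space le_el_iff_ex[OF radon_null radon_null MN]
    by (auto simp: dif_null_right)
  then have "X = el R (null_measure borel)"
    by (simp add: X el_eq_iff MN radon_null dif_null_right)
  with R(1) show ?thesis
    using that by blast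
qed

text \<open>The real net that dominates the values of \<open>f\<close> is obtained by pairing the
  dominating net \<open>y\<close> with the absolute value of \<open>f\<close>.\<close>

lemma hat_order_continuous:
  assumes f: "f \<in> LC"
  shows "order_continuous TYPE('i) (M1_space A) (hat A f)"
  unfolding order_continuous_def
proof (intro allI impI)
  fix I :: "'i set" and r x
  assume I: "directed_index I r" and x: "\<forall>i\<in>I. x i \<in> carrier (M1_space A)"
    and "order_null (M1_space A) I r x"
  then obtain y where y: "\<And>i. i \<in> I \<Longrightarrow> y i \<in> carrier (M1_space A)"
    and dec: "\<And>i j. i \<in> I \<Longrightarrow> j \<in> I \<Longrightarrow> r i j \<Longrightarrow> y j \<sqsubseteq>\<^bsub>M1_space A\<^esub> y i"
    and glb: "is_glb (M1_space A) (vzero (M1_space A)) (y ` I)"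
    and xy: "\<And>i. i \<in> I \<Longrightarrow> vabs (M1_space A) (x i) \<sqsubseteq>\<^bsub>M1_space A\<^esub> y i"
    unfolding order_null_def by blast
  let ?g = "\<lambda>x. \<bar>f x\<bar>" and ?o = "null_measure borel :: 'a measure"
  note g = LC_abs[OF f]
  have "vzero (M1_space A) \<sqsubseteq>\<^bsub>M1_space A\<^esub> y i" if "i \<in> I" for i
    using glb y[OF that] that by (auto simp: greatest_def Lower_def)
  then have "\<exists>R. radon R \<and> y i = el R ?o" if "i \<in> I" for i
    using pos_el[OF y[OF that]] that by blast
  then obtain \<nu> where \<nu>: "\<And>i. i \<in> I \<Longrightarrow> radon (\<nu> i)" and y\<nu>: "\<And>i. i \<in> I \<Longrightarrow> y i = el (\<nu> i) ?o"
    by metis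
  have dec\<nu>: "measure (\<nu> j) E \<le> measure (\<nu> i) E" if "i \<in> I" "j \<in> I" "r i j" "small E" for i j E
    using dec[OF that(1,2,3)] that(4)
    unfolding y\<nu>[OF that(1)] y\<nu>[OF that(2)] le_el_iff[OF \<nu>[OF that(2)] radon_null \<nu>[OF that(1)] radon_null]
    by (simp add: dif_null_right)
  have I0: "I \<noteq> {}"
    using I by (simp add: directed_index_def)
  have dir: "\<exists>k\<in>I. \<forall>E. small E \<longrightarrow>
      emeasure (\<nu> k) E \<le> emeasure (\<nu> i) E \<and> emeasure (\<nu> k) E \<le> emeasure (\<nu> j) E" if ij: "i \<in> I" "j \<in> I" for i j
  proof -
    obtain k where k: "k \<in> I" "r i k" "r j k"
      using I ij by (auto simp: directed_index_def)
    have "emeasure (\<nu> k) E \<le> emeasure (\<nu> i) E \<and> emeasure (\<nu> k) E \<le> emeasure (\<nu> j) E" if E: "small E" for E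
      using dec\<nu>[OF ij(1) k(1,2) E] dec\<nu>[OF ij(2) k(1,3) E]
      by (simp add: emeasure_small \<nu> k(1) ij E ennreal_leI)
    with k(1) show ?thesis
      by blast
  qed
  obtain R where R: "radon R" "\<And>E. small E \<Longrightarrow> emeasure R E = (INF i\<in>I. emeasure (\<nu> i) E)"
    by (rule radon_INF[OF I0 \<nu> dir]) blast+
  have R\<nu>: "measure R E \<le> measure (\<nu> i) E" if "i \<in> I" "small E" for i E
  proof -
    have "ennreal (measure R E) \<le> ennreal (measure (\<nu> i) E)"
      unfolding emeasure_small[OF R(1) that(2), symmetric] emeasure_small[OF \<nu>[OF that(1)] that(2), symmetric] R(2)[OF that(2)]
      by (rule INF_lower[OF that(1)])
    then show ?thesis
      by simp
  qed
  \<comment> \<open>Here the abstract infimum becomes a setwise one: the setwise infimum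
    \<open>R\<close> is an admissible lower bound, hence below zero, so it vanishes on small
    sets.\<close>
  have "el R ?o \<in> Lower (M1_space A) (y ` I)"
    by (auto simp: Lower_def y\<nu> le_el_iff R(1) \<nu> radon_null dif_null_right R\<nu> el_carrier)
  then have "el R ?o \<sqsubseteq>\<^bsub>M1_space A\<^esub> el ?o ?o"
    using glb unfolding greatest_def vzero_M1_space by blast
  then have "measure R E \<le> 0" if "small E" for E
    using that unfolding le_el_iff[OF R(1) radon_null radon_null radon_null] by (simp add: dif_null_right)
  then have null: "(INF i\<in>I. emeasure (\<nu> i) E) = 0" if "small E" for E
    unfolding R(2)[OF that, symmetric] emeasure_small[OF R(1) that] using that by (simp add: ennreal_neg)
  have z: "hat A ?g (y i) = integral\<^sup>L (\<nu> i) ?g" if "i \<in> I" for i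
    by (simp add: y\<nu>[OF that] hat_el[OF g \<nu>[OF that] radon_null])
  show "order_null real_vs I r (\<lambda>i. hat A f (x i))"
    unfolding order_null_def
  proof (intro exI[of _ "\<lambda>i. hat A ?g (y i)"] conjI ballI impI)
    fix i j assume "i \<in> I" "j \<in> I" "r i j"
    then show "hat A ?g (y j) \<sqsubseteq>\<^bsub>real_vs\<^esub> hat A ?g (y i)"
      using y dec g by (auto simp: real_vs_def intro!: hat_mono)
  next
    fix i assume "i \<in> I"
    then show "vabs real_vs (hat A f (x i)) \<sqsubseteq>\<^bsub>real_vs\<^esub> hat A ?g (y i)"
      using abs_hat_le[OF f _ y xy] x by (simp add: vabs_real_vs) (simp add: real_vs_def)
  next
    have "0 \<le> hat A ?g (y i)" if "i \<in> I" for i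
      by (simp add: z[OF that])
    moreover have "l \<le> 0" if l: "\<And>i. i \<in> I \<Longrightarrow> l \<le> hat A ?g (y i)" for l
    proof (rule ccontr)
      assume "\<not> l \<le> 0"
      then have "0 < l"
        by simp
      then obtain i where "i \<in> I" "integral\<^sup>L (\<nu> i) ?g < l"
        using integral_decreasing_net_null[OF I \<nu> dec\<nu> null g] by auto
      then show False
        using l[of i] z[of i] by simp
    qed
    ultimately show "is_glb real_vs (vzero real_vs) ((\<lambda>i. hat A ?g (y i)) ` I)"
      by (auto simp: greatest_def Lower_def real_vs_def)
  qed (simp add: real_vs_def)
qed

end

section \<open>The embedding\<close>

context closed_pair
begin

lemma radon_return:
  assumes "x \<notin> A"
  shows "radon (return borel x)"
proof -
  have "rel_tight A (return borel x)"
  proof (rule rel_tightI)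
    fix E c assume "E \<in> sets borel" "c < emeasure (return borel x) E"
    then show "\<exists>K. compact K \<and> K \<subseteq> E \<and> c < emeasure (return borel x) K"
      by (intro exI[of _ "{x}"]) (cases "x \<in> E"; simp)
  qed simp
  moreover have "locally_1_finite A (return borel x)"
    unfolding locally_1_finite_def
  proof (intro allI exI[of _ UNIV] conjI)
    have "(\<lambda>y. ennreal (infdist y A) * indicator (UNIV - A) y) \<in> borel_measurable borel"
      by measurable
    then show "(\<integral>\<^sup>+y\<in>UNIV - A. ennreal (infdist y A) \<partial>return borel x) < \<infinity>"
      by (simp add: nn_integral_return indicator_def)
  qed auto
  ultimately show ?thesis
    by (simp add: radon_def)
qed

text \<open>Point masses off \<open>A\<close> recover the values there, and on \<open>A\<close> both
  functions vanish.\<close>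

lemma hat_inj: "inj_on (hat A) LC"
proof (rule inj_onI, rule ext)
  fix f g x assume f: "f \<in> LC" and g: "g \<in> LC" and eq: "hat A f = hat A g"
  show "f x = g x"
  proof (cases "x \<in> A")
    case False
    note \<delta> = radon_return[OF False]
    have *: "hat A h (el (return borel x) (null_measure borel)) = h x" if "h \<in> LC" for h
      using LC_measurable[OF that] by (simp add: hat_el[OF that \<delta> radon_null] integral_return)
    show ?thesis
      using *[OF f] *[OF g] eq by simp
  qed (simp add: LC_zero f g)
qed

section \<open>The order of the dual and splitting of measures\<close>

abbreviation pos :: "'a measure \<Rightarrow> ('a measure set \<times> 'a measure set) set" where
  "pos M \<equiv> el M (null_measure borel)"

lemma hat_pos: "f \<in> LC \<Longrightarrow> radon R \<Longrightarrow> hat A f (pos R) = integral\<^sup>L R f"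
  by (simp add: hat_el radon_null)

text \<open>A competing bound in the dual need not be given by integration, so the decomposition of
  the measure is carried out inside the group, where linearity alone applies.\<close>

lemma linear_functional_restr_split:
  assumes T: "linear_functional (M1_space A) T" and R: "radon R" and B: "B \<in> sets borel"
  shows "T (pos R) = T (pos (restr R B)) + T (pos (restr R (- B)))"
proof -
  have rad: "radon (restr R B)" "radon (restr R (- B))"
    using R B by (auto intro: radon_restr)
  have "pos R = vadd (M1_space A) (pos (restr R B)) (pos (restr R (- B)))"
    using R B by (simp add: vadd_el el_eq_iff rad radon_null radon_add dif_add dif_null_right
        measure_restr_small measure_small_split[OF R _ B])
  then show ?thesis
    using T rad by (simp add: linear_functional_def el_carrier radon_null)
qed

lemma hat_restr_cong:
  assumes "f \<in> LC" "g \<in> LC" "radon R" "B \<in> sets borel" "\<And>x. x \<in> B \<Longrightarrow> f x = g x"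
  shows "hat A f (pos (restr R B)) = hat A g (pos (restr R B))"
proof -
  have "(\<integral>x. indicator B x * f x \<partial>R) = (\<integral>x. indicator B x * g x \<partial>R)"
    using assms(5) by (intro Bochner_Integration.integral_cong) (auto simp: indicator_def)
  then show ?thesis
    using assms by (simp add: hat_pos radon_restr integral_restr_radon)
qed

lemma pos_ge_vzero: "radon R \<Longrightarrow> vzero (M1_space A) \<sqsubseteq>\<^bsub>M1_space A\<^esub> pos R"
  by (simp add: vzero_M1_space le_el_iff radon_null dif_null_right)

lemma closed_LC_le: "f \<in> LC \<Longrightarrow> g \<in> LC \<Longrightarrow> {x. g x \<le> f x} \<in> sets borel"
  by (intro borel_closed closed_Collect_le LC_cont)

context
  fixes F :: "(('a measure set \<times> 'a measure set) set \<Rightarrow> real) ordered_vs"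
  defines "F \<equiv> order_continuous_dual TYPE('i) (M1_space A)"
begin

lemma hat_carrier: "f \<in> LC \<Longrightarrow> hat A f \<in> carrier F"
  by (simp add: F_def order_continuous_dual_def hat_linear hat_order_bounded hat_order_continuous)
    (simp add: hat_def)

text \<open>Each positive element of the space is a single Radon measure, so the order of the dual
  is tested on these.\<close>

lemma le_dual_iff:
  "S \<sqsubseteq>\<^bsub>F\<^esub> T \<longleftrightarrow> (\<forall>R. radon R \<longrightarrow> S (pos R) \<le> T (pos R))"
proof
  assume "S \<sqsubseteq>\<^bsub>F\<^esub> T"
  then have "0 \<le> T (pos R) - S (pos R)" if "radon R" for R
    using that pos_ge_vzero[OF that] el_carrier[OF that radon_null]
    unfolding F_def order_continuous_dual_def by simp
  then show "\<forall>R. radon R \<longrightarrow> S (pos R) \<le> T (pos R)"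
    by simp
next
  assume *: "\<forall>R. radon R \<longrightarrow> S (pos R) \<le> T (pos R)"
  have "0 \<le> T X - S X" if X: "X \<in> carrier (M1_space A)" "vzero (M1_space A) \<sqsubseteq>\<^bsub>M1_space A\<^esub> X" for X
  proof -
    obtain R where "radon R" "X = pos R"
      by (rule pos_el[OF X])
    with * show ?thesis
      by simp
  qed
  then show "S \<sqsubseteq>\<^bsub>F\<^esub> T"
    by (simp add: F_def order_continuous_dual_def)
qed

lemma dual_linear: "T \<in> carrier F \<Longrightarrow> linear_functional (M1_space A) T"
  by (simp add: F_def order_continuous_dual_def)

text \<open>
  On the restrictions of a measure to \<open>{g \<le> f}\<close> and its complement, the functional of the maximum
  agrees with that of \<open>f\<close> and that of \<open>g\<close>, respectively.
\<close>

lemma hat_max_lub: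
  assumes f: "f \<in> LC" and g: "g \<in> LC"
  shows "is_lub F (hat A (\<lambda>x. max (f x) (g x))) {hat A f, hat A g}"
  unfolding least_def
proof (intro conjI ballI)
  let ?m = "\<lambda>x. max (f x) (g x)" and ?B = "{x. g x \<le> f x}"
  note m = LC_max[OF f g] and B = closed_LC_le[OF f g]
  show "Upper F {hat A f, hat A g} \<subseteq> carrier F"
    by (auto simp: Upper_def)
  have "integral\<^sup>L R f \<le> integral\<^sup>L R ?m" "integral\<^sup>L R g \<le> integral\<^sup>L R ?m" if "radon R" for R
    by (intro integral_mono LC_integrable f g m that; simp)+
  then show "hat A ?m \<in> Upper F {hat A f, hat A g}"
    by (auto simp: Upper_def hat_carrier m le_dual_iff hat_pos f g)
  fix u assume "u \<in> Upper F {hat A f, hat A g}"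
  then have u: "u \<in> carrier F" "hat A f \<sqsubseteq>\<^bsub>F\<^esub> u" "hat A g \<sqsubseteq>\<^bsub>F\<^esub> u"
    using hat_carrier[OF f] hat_carrier[OF g] by (auto simp: Upper_def)
  show "hat A ?m \<sqsubseteq>\<^bsub>F\<^esub> u"
    unfolding le_dual_iff
  proof (intro allI impI)
    fix R assume R: "radon R"
    have B': "- ?B \<in> sets borel"
      using B by auto
    have "hat A ?m (pos R) = hat A ?m (pos (restr R ?B)) + hat A ?m (pos (restr R (- ?B)))"
      by (rule linear_functional_restr_split[OF hat_linear[OF m] R B])
    also have "hat A ?m (pos (restr R ?B)) = hat A f (pos (restr R ?B))"
      by (rule hat_restr_cong[OF m f R B]) auto
    also have "hat A ?m (pos (restr R (- ?B))) = hat A g (pos (restr R (- ?B)))"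
      by (rule hat_restr_cong[OF m g R B']) auto
    also have "hat A f (pos (restr R ?B)) + hat A g (pos (restr R (- ?B)))
      \<le> u (pos (restr R ?B)) + u (pos (restr R (- ?B)))"
      using u(2,3) radon_restr[OF R B] radon_restr[OF R B'] unfolding le_dual_iff by (intro add_mono) auto
    also have "\<dots> = u (pos R)"
      by (rule linear_functional_restr_split[OF dual_linear[OF u(1)] R B, symmetric])
    finally show "hat A ?m (pos R) \<le> u (pos R)" .
  qed
qed

text \<open>On the restriction to \<open>{g \<le> f}\<close> a lower bound is estimated by
  \<open>g\<close>, on the complement by \<open>f\<close>; in each case this function is the minimum
  there.\<close>

lemma hat_min_glb:
  assumes f: "f \<in> LC" and g: "g \<in> LC"
  shows "is_glb F (hat A (\<lambda>x. min (f x) (g x))) {hat A f, hat A g}"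
  unfolding greatest_def
proof (intro conjI ballI)
  let ?m = "\<lambda>x. min (f x) (g x)" and ?B = "{x. g x \<le> f x}"
  note m = LC_min[OF f g] and B = closed_LC_le[OF f g]
  show "Lower F {hat A f, hat A g} \<subseteq> carrier F"
    by (auto simp: Lower_def)
  have "integral\<^sup>L R ?m \<le> integral\<^sup>L R f" "integral\<^sup>L R ?m \<le> integral\<^sup>L R g" if "radon R" for R
    by (intro integral_mono LC_integrable f g m that; simp)+
  then show "hat A ?m \<in> Lower F {hat A f, hat A g}"
    by (auto simp: Lower_def hat_carrier m le_dual_iff hat_pos f g)
  fix u assume "u \<in> Lower F {hat A f, hat A g}"
  then have u: "u \<in> carrier F" "u \<sqsubseteq>\<^bsub>F\<^esub> hat A f" "u \<sqsubseteq>\<^bsub>F\<^esub> hat A g"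
    using hat_carrier[OF f] hat_carrier[OF g] by (auto simp: Lower_def)
  show "u \<sqsubseteq>\<^bsub>F\<^esub> hat A ?m"
    unfolding le_dual_iff
  proof (intro allI impI)
    fix R assume R: "radon R"
    have B': "- ?B \<in> sets borel"
      using B by auto
    have "u (pos R) = u (pos (restr R ?B)) + u (pos (restr R (- ?B)))"
      by (rule linear_functional_restr_split[OF dual_linear[OF u(1)] R B])
    also have "\<dots> \<le> hat A g (pos (restr R ?B)) + hat A f (pos (restr R (- ?B)))"
      using u(2,3) radon_restr[OF R B] radon_restr[OF R B'] unfolding le_dual_iff by (intro add_mono) auto
    also have "hat A g (pos (restr R ?B)) = hat A ?m (pos (restr R ?B))"
      by (rule hat_restr_cong[OF g m R B]) auto
    also have "hat A f (pos (restr R (- ?B))) = hat A ?m (pos (restr R (- ?B)))"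
      by (rule hat_restr_cong[OF f m R B']) auto
    also have "hat A ?m (pos (restr R ?B)) + hat A ?m (pos (restr R (- ?B))) = hat A ?m (pos R)"
      by (rule linear_functional_restr_split[OF hat_linear[OF m] R B, symmetric])
    finally show "u (pos R) \<le> hat A ?m (pos R)" .
  qed
qed

section \<open>Preservation of the vector lattice structure\<close>

lemma join_Lip_c:
  assumes "f \<in> LC" "g \<in> LC"
  shows "f \<squnion>\<^bsub>Lip_c A\<^esub> g = (\<lambda>x. max (f x) (g x))"
proof (rule join_eqI)
  show "is_lub (Lip_c A) (\<lambda>x. max (f x) (g x)) {f, g}"
    using LC_max[OF assms] assms
    by (auto simp: least_def Upper_def LC_def[symmetric]) (auto simp: Lip_c_def)
qed (simp add: Lip_c_def, metis antisym ext)

lemma meet_Lip_c: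
  assumes "f \<in> LC" "g \<in> LC"
  shows "f \<sqinter>\<^bsub>Lip_c A\<^esub> g = (\<lambda>x. min (f x) (g x))"
proof (rule meet_eqI)
  show "is_glb (Lip_c A) (\<lambda>x. min (f x) (g x)) {f, g}"
    using LC_min[OF assms] assms
    by (auto simp: greatest_def Lower_def LC_def[symmetric]) (auto simp: Lip_c_def)
qed (simp add: Lip_c_def, metis antisym ext)

text \<open>In the algebraic identities both sides are extensional, so equality on the carrier of
  \<open>M1_space A\<close> is enough.\<close>

lemma hat_riesz_embedding: "riesz_embedding (Lip_c A) F (hat A)"
  unfolding riesz_embedding_def LC_def[symmetric]
proof (intro conjI ballI allI)
  show "hat A \<in> LC \<rightarrow> carrier F"
    using hat_carrier by blast
  show "inj_on (hat A) LC"
    by (rule hat_inj)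
  fix f assume f: "f \<in> LC"
  show "hat A (vscale (Lip_c A) c f) = vscale F c (hat A f)" for c
  proof -
    have "hat A (\<lambda>x. c * f x) = (\<lambda>X\<in>carrier (M1_space A). c * hat A f X)"
    proof (rule extensionalityI)
      show "hat A (\<lambda>x. c * f x) \<in> extensional (carrier (M1_space A))"
        by (simp add: hat_def)
    qed (simp_all add: hat_cmult[OF f])
    then show ?thesis
      by (simp add: F_def order_continuous_dual_def Lip_c_def)
  qed
  fix g assume g: "g \<in> LC"
  show "hat A (vadd (Lip_c A) f g) = vadd F (hat A f) (hat A g)"
  proof -
    have "hat A (\<lambda>x. f x + g x) = (\<lambda>X\<in>carrier (M1_space A). hat A f X + hat A g X)"
    proof (rule extensionalityI)
      show "hat A (\<lambda>x. f x + g x) \<in> extensional (carrier (M1_space A))"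
        by (simp add: hat_def)
    qed (simp_all add: hat_add[OF f g])
    then show ?thesis
      by (simp add: F_def order_continuous_dual_def Lip_c_def)
  qed
  show "is_lub F (hat A (f \<squnion>\<^bsub>Lip_c A\<^esub> g)) {hat A f, hat A g}"
    unfolding join_Lip_c[OF f g] by (rule hat_max_lub[OF f g])
  show "is_glb F (hat A (f \<sqinter>\<^bsub>Lip_c A\<^esub> g)) {hat A f, hat A g}"
    unfolding meet_Lip_c[OF f g] by (rule hat_min_glb[OF f g])
qed

end

end

theorem corollary1p6:
  fixes A :: "'a::metric_space set"
  assumes "closed A" and "A \<noteq> {}"
    and "locally_compact_space (euclidean :: 'a topology)"
  shows "riesz_embedding (Lip_c A) (order_continuous_dual TYPE('i) (M1_space A)) (hat A)"
proof -
  interpret closed_pair A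
    using assms by unfold_locales
  show ?thesis
    by (rule hat_riesz_embedding)
qed

end
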